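(* Let $d \ge 2$. Let $v^n, v \in \mathrm{BV}_V(\Omega)$ with $v^n \to v$ strictly. Let $g^n \rightharpoonup g$ weakly in $L^2(\Omega)$. Let $\Delta > 0$. Then the functionals $T^n : (\mathrm{BV}_V(\Omega), \text{weak-}^* ) \to \mathbb{R}\cup\{\infty\}$ defined by $$T^n(w) := (g^n, w - v^n)_{L^2} + \alpha \mathrm{TV}(w)-\alpha \mathrm{TV}(v^n) + \delta_{[0,\Delta]}(\|w - v^n\|_{L^1}),\quad w \in \mathrm{BV}_V(\Omega),$$ $\Gamma$-converge to the functional $T : (\mathrm{BV}_V(\Omega), \text{weak-}^* ) \to \mathbb{R}\cup\{\infty\}$ defined by $$T(w) := (g, w - v)_{L^2} + \alpha \mathrm{TV}(w)-\alpha \mathrm{TV}(v) + \delta_{[0,\Delta]}(\|w - v\|_{L^1}),\quad w \in \mathrm{BV}_V(\Omega),$$ where $\delta_{[0,\Delta]}$ is the $\{0,\infty\}$-valued indicator function of $[0,\Delta]$.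
   Context: Standing assumptions: $\alpha > 0$, $\Omega \subset \mathbb{R}^d$ is a bounded Lipschitz domain, and $V = \{\nu_1,\ldots,\nu_M\} \subset \mathbb{Z}$ is a set of $M$ pairwise distinct integers. $\mathrm{TV}(u) = |Du|(\Omega)$, and $\mathrm{BV}_V(\Omega) = \{v \in \mathrm{BV}(\Omega) : v(x) \in V \text{ for a.a. } x \in \Omega\}$. A sequence $(v^n)_n\subset \mathrm{BV}(\Omega)$ converges weakly-$^*$ to $v \in \mathrm{BV}(\Omega)$ if $v^n \to v$ in $L^1(\Omega)$ and $\limsup_n \mathrm{TV}(v^n) < \infty$; it converges strictly to $v$ if $v^n \to v$ in $L^1(\Omega)$ and $\mathrm{TV}(v^n) \to \mathrm{TV}(v)$. $\Gamma$-convergence of $T^n$ to $T$ with respect to weak-$^*$ convergence means: (i) (lower bound inequality) $T(w) \le \liminf_{n\to\infty} T^n(w^n)$ whenever $w^n, w\in \mathrm{BV}_V(\Omega)$ and $w^n$ converges weakly-$^*$ to $w$; (ii) (upper bound inequality) for each $w \in \mathrm{BV}_V(\Omega)$ there is a sequence $(w^n)_n \subset \mathrm{BV}_V(\Omega)$ converging weakly-$^*$ to $w$ with $T(w) \ge \limsup_{n\to\infty} T^n(w^n)$. *)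

theory Defs
  imports "HOL-Analysis.Analysis"
begin

section \<open>Bounded Lipschitz domains\<close>

text \<open>
  Near every boundary point, and up to a rigid change of coordinates, the domain is the strict
  epigraph of a Lipschitz function of \<open>d - 1\<close> variables.  The change of coordinates is encoded by
  the unit vector \<open>e\<close> giving the vertical direction: \<open>x \<bullet> e\<close> is the last coordinate of \<open>x\<close>, and
  \<open>x - (x \<bullet> e) *\<^sub>R e\<close>, a point of the hyperplane orthogonal to \<open>e\<close>, stands for the others.
\<close>

definition lipschitz_boundary :: "'a::euclidean_space set \<Rightarrow> bool" where
  "lipschitz_boundary \<Omega> \<longleftrightarrow>
     (\<forall>p\<in>frontier \<Omega>. \<exists>e r L \<gamma>. norm e = 1 \<and> r > 0 \<and>
        L-lipschitz_on {y. y \<bullet> e = 0} (\<gamma> :: 'a \<Rightarrow> real) \<and>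
        \<Omega> \<inter> ball p r = {x \<in> ball p r. \<gamma> (x - (x \<bullet> e) *\<^sub>R e) < x \<bullet> e})"

definition bounded_lipschitz_domain :: "'a::euclidean_space set \<Rightarrow> bool" where
  "bounded_lipschitz_domain \<Omega> \<longleftrightarrow>
     \<Omega> \<noteq> {} \<and> open \<Omega> \<and> connected \<Omega> \<and> bounded \<Omega> \<and> lipschitz_boundary \<Omega>"

section \<open>Lebesgue spaces\<close>

text \<open>
  Elements of \<open>L\<^sup>1(\<Omega>)\<close> and \<open>L\<^sup>2(\<Omega>)\<close> are represented by functions on the ambient space; only the
  values on \<open>\<Omega>\<close>, up to null sets, enter the notions below.
\<close>

definition L1_norm :: "'a::euclidean_space set \<Rightarrow> ('a \<Rightarrow> real) \<Rightarrow> real" where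
  "L1_norm \<Omega> u = (LINT x|lebesgue_on \<Omega>. \<bar>u x\<bar>)"

definition L2_space :: "'a::euclidean_space set \<Rightarrow> ('a \<Rightarrow> real) set" where
  "L2_space \<Omega> = {u \<in> borel_measurable (lebesgue_on \<Omega>). integrable (lebesgue_on \<Omega>) (\<lambda>x. (u x)\<^sup>2)}"

definition L2_inner :: "'a::euclidean_space set \<Rightarrow> ('a \<Rightarrow> real) \<Rightarrow> ('a \<Rightarrow> real) \<Rightarrow> real" where
  "L2_inner \<Omega> u v = (LINT x|lebesgue_on \<Omega>. u x * v x)"

definition L2_weakly_converges ::
    "'a::euclidean_space set \<Rightarrow> (nat \<Rightarrow> 'a \<Rightarrow> real) \<Rightarrow> ('a \<Rightarrow> real) \<Rightarrow> bool" where
  "L2_weakly_converges \<Omega> g\<^sub>n g \<longleftrightarrow>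
     (\<forall>n. g\<^sub>n n \<in> L2_space \<Omega>) \<and> g \<in> L2_space \<Omega> \<and>
     (\<forall>h\<in>L2_space \<Omega>. (\<lambda>n. L2_inner \<Omega> (g\<^sub>n n) h) \<longlonglongrightarrow> L2_inner \<Omega> g h)"

section \<open>Functions of bounded variation\<close>

definition divergence :: "('a::euclidean_space \<Rightarrow> 'a) \<Rightarrow> 'a \<Rightarrow> real" where
  "divergence \<phi> x = (\<Sum>b\<in>Basis. frechet_derivative \<phi> (at x) b \<bullet> b)"

text \<open>
  The space \<open>C\<^sub>c\<^sup>1(\<Omega>; \<real>\<^sup>d)\<close>, its elements being extended by zero to the whole space.
\<close>

definition C1c_fields :: "'a::euclidean_space set \<Rightarrow> ('a \<Rightarrow> 'a) set" where
  "C1c_fields \<Omega> = {\<phi>. (\<forall>x. \<phi> differentiable (at x)) \<and>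
     (\<forall>h. continuous_on UNIV (\<lambda>x. frechet_derivative \<phi> (at x) h)) \<and>
     compact (closure {x. \<phi> x \<noteq> 0}) \<and> closure {x. \<phi> x \<noteq> 0} \<subseteq> \<Omega>}"

text \<open>
  The total variation \<open>|Du|(\<Omega>)\<close> of the distributional derivative of \<open>u\<close>, for \<open>u\<close> in \<open>L\<^sup>1(\<Omega>)\<close>.
\<close>

definition TV :: "'a::euclidean_space set \<Rightarrow> ('a \<Rightarrow> real) \<Rightarrow> ereal" where
  "TV \<Omega> u = (SUP \<phi>\<in>{\<phi> \<in> C1c_fields \<Omega>. \<forall>x. norm (\<phi> x) \<le> 1}.
     ereal (LINT x|lebesgue_on \<Omega>. u x * divergence \<phi> x))"

definition BV :: "'a::euclidean_space set \<Rightarrow> ('a \<Rightarrow> real) set" where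
  "BV \<Omega> = {u. integrable (lebesgue_on \<Omega>) u \<and> TV \<Omega> u < \<infinity>}"

definition BV_values :: "int set \<Rightarrow> 'a::euclidean_space set \<Rightarrow> ('a \<Rightarrow> real) set" where
  "BV_values V \<Omega> = {u \<in> BV \<Omega>. AE x in lebesgue_on \<Omega>. u x \<in> real_of_int ` V}"

definition weak_star_converges ::
    "'a::euclidean_space set \<Rightarrow> (nat \<Rightarrow> 'a \<Rightarrow> real) \<Rightarrow> ('a \<Rightarrow> real) \<Rightarrow> bool" where
  "weak_star_converges \<Omega> v\<^sub>n v \<longleftrightarrow>
     (\<forall>n. v\<^sub>n n \<in> BV \<Omega>) \<and> v \<in> BV \<Omega> \<and>
     (\<lambda>n. L1_norm \<Omega> (\<lambda>x. v\<^sub>n n x - v x)) \<longlonglongrightarrow> 0 \<and> limsup (\<lambda>n. TV \<Omega> (v\<^sub>n n)) < \<infinity>"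

definition strictly_converges ::
    "'a::euclidean_space set \<Rightarrow> (nat \<Rightarrow> 'a \<Rightarrow> real) \<Rightarrow> ('a \<Rightarrow> real) \<Rightarrow> bool" where
  "strictly_converges \<Omega> v\<^sub>n v \<longleftrightarrow>
     (\<forall>n. v\<^sub>n n \<in> BV \<Omega>) \<and> v \<in> BV \<Omega> \<and>
     (\<lambda>n. L1_norm \<Omega> (\<lambda>x. v\<^sub>n n x - v x)) \<longlonglongrightarrow> 0 \<and> (\<lambda>n. TV \<Omega> (v\<^sub>n n)) \<longlonglongrightarrow> TV \<Omega> v"

section \<open>Gamma-convergence\<close>

text \<open>
  Sequential Gamma-convergence on \<open>X\<close>, where \<open>conv\<close> is the underlying notion of convergence of
  sequences.
\<close>

definition Gamma_converges ::
    "'b set \<Rightarrow> ((nat \<Rightarrow> 'b) \<Rightarrow> 'b \<Rightarrow> bool) \<Rightarrow> (nat \<Rightarrow> 'b \<Rightarrow> ereal) \<Rightarrow> ('b \<Rightarrow> ereal) \<Rightarrow> bool" where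
  "Gamma_converges X conv T\<^sub>n T \<longleftrightarrow>
     (\<forall>w\<^sub>n w. (\<forall>n. w\<^sub>n n \<in> X) \<longrightarrow> w \<in> X \<longrightarrow> conv w\<^sub>n w \<longrightarrow> T w \<le> liminf (\<lambda>n. T\<^sub>n n (w\<^sub>n n))) \<and>
     (\<forall>w\<in>X. \<exists>w\<^sub>n. (\<forall>n. w\<^sub>n n \<in> X) \<and> conv w\<^sub>n w \<and> limsup (\<lambda>n. T\<^sub>n n (w\<^sub>n n)) \<le> T w)"

section \<open>The trust-region functionals\<close>

definition indicator_infty :: "'b set \<Rightarrow> 'b \<Rightarrow> ereal" where
  "indicator_infty S x = (if x \<in> S then 0 else \<infinity>)"

definition TR_functional ::
    "'a::euclidean_space set \<Rightarrow> real \<Rightarrow> real \<Rightarrow> ('a \<Rightarrow> real) \<Rightarrow> ('a \<Rightarrow> real) \<Rightarrow> ('a \<Rightarrow> real) \<Rightarrow> ereal" where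
  "TR_functional \<Omega> \<alpha> \<Delta> g v w =
     ereal (L2_inner \<Omega> g (\<lambda>x. w x - v x)) + ereal \<alpha> * TV \<Omega> w - ereal \<alpha> * TV \<Omega> v
       + indicator_infty {0..\<Delta>} (L1_norm \<Omega> (\<lambda>x. w x - v x))"

text \<open>
  On \<open>BV(\<Omega>)\<close> the total variations are finite, so the functionals take values in
  \<open>\<real> \<union> {\<infinity>}\<close> and no undetermined sum of infinities occurs in them.
\<close>

lemma TV_nonneg: "0 \<le> TV \<Omega> u"
proof -
  have "(\<lambda>_. 0) \<in> {\<phi> \<in> C1c_fields \<Omega>. \<forall>x. norm (\<phi> x) \<le> 1}"
    by (simp add: C1c_fields_def)
  then have "ereal (LINT x|lebesgue_on \<Omega>. u x * divergence (\<lambda>_. 0) x) \<le> TV \<Omega> u"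
    unfolding TV_def by (rule SUP_upper)
  then show ?thesis
    by (simp add: divergence_def zero_ereal_def)
qed

lemma TR_functional_not_MInfty:
  assumes "v \<in> BV \<Omega>" "w \<in> BV \<Omega>"
  shows "TR_functional \<Omega> \<alpha> \<Delta> g v w \<noteq> -\<infinity>"
proof -
  obtain a where a: "TV \<Omega> v = ereal a"
    using assms(1) TV_nonneg[of \<Omega> v] by (cases "TV \<Omega> v") (auto simp: BV_def)
  obtain b where b: "TV \<Omega> w = ereal b"
    using assms(2) TV_nonneg[of \<Omega> w] by (cases "TV \<Omega> w") (auto simp: BV_def)
  show ?thesis
    by (simp add: TR_functional_def indicator_infty_def a b)
qed

end

theory Submission
  imports Defs
begin

text \<open>
  The linear term \<open>(g\<^sup>n, w\<^sup>n - v\<^sup>n)\<close> converges along every admissible sequence.  Functions with values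
  in the finite set \<open>V\<close> are uniformly bounded, so their convergence in \<open>L\<^sup>1\<close> upgrades to convergence
  in \<open>L\<^sup>2\<close> (\<open>BV_values_L1_imp_L2_tendsto\<close>), and the product of a weakly and a strongly convergent
  sequence converges (\<open>weak_strong_product\<close>).  The term \<open>\<alpha> TV(v\<^sup>n)\<close> converges because \<open>v\<^sup>n\<close>
  converges strictly, and \<open>\<parallel>w\<^sup>n - v\<^sup>n\<parallel>\<close> tends to \<open>\<parallel>w - v\<parallel>\<close> in \<open>L\<^sup>1\<close>.  With the lower semicontinuity of
  \<open>TV\<close> this gives the lower bound inequality, since the limit of points of the closed trust region
  lies in the trust region.

  For the upper bound inequality the constant sequence \<open>w\<^sup>n = w\<close> serves if \<open>\<parallel>w - v\<parallel> < \<Delta>\<close>, because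
  it is then feasible for all large \<open>n\<close>.  The difficulty is \<open>\<parallel>w - v\<parallel> = \<Delta>\<close>, where \<open>w\<close> can be
  infeasible for every \<open>n\<close>; it has to be moved closer to \<open>v\<close> by an arbitrarily small change that
  keeps the values in \<open>V\<close> and increases the total variation arbitrarily little.  As \<open>\<Delta> > 0\<close>, there
  are \<open>a \<noteq> b\<close> in \<open>V\<close> such that \<open>w = a\<close> and \<open>v = b\<close> on a set \<open>E\<close> of positive measure.  By Vitali's
  covering theorem there are arbitrarily small balls that \<open>E\<close> fills but for a small fraction
  (\<open>exists_small_ball_mostly_in\<close>).  Replacing \<open>w\<close> by the constant \<open>b\<close> on such a ball of radius \<open>r\<close>
  decreases the distance to \<open>v\<close>, the gain on \<open>E\<close> exceeding any loss on the rest of the ball, and it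
  increases the total variation at most by a multiple of the perimeter, which is of order
  \<open>r\<^bsup>d - 1\<^esup>\<close> (\<open>TV_set_zero_on_ball\<close>).  This is where \<open>d \<ge> 2\<close> enters: the perimeter
  tends to zero with \<open>r\<close>.  The resulting functions (\<open>closer_competitor\<close>) are feasible for all large
  \<open>n\<close>, and a diagonal sequence formed from them recovers \<open>T(w)\<close>.

  The perimeter estimate rests on the product rule.  For a test field \<open>\<phi>\<close> and a cutoff \<open>\<eta>\<close> that vanishes on the ball and equals one outside a slightly larger
  concentric ball, \<open>\<integral> u \<eta> div \<phi> = \<integral> u div (\<eta> \<phi>) - \<integral> u \<nabla>\<eta> \<bullet> \<phi>\<close>.  The first integral on the right is
  at most \<open>TV u\<close>, and the second is controlled by the volume of an annulus divided by its width.
\<close>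

section \<open>Products of weakly and strongly convergent sequences\<close>

definition square_integrable :: "'b measure \<Rightarrow> ('b \<Rightarrow> real) \<Rightarrow> bool" where
  "square_integrable M u \<longleftrightarrow> u \<in> borel_measurable M \<and> integrable M (\<lambda>x. (u x)\<^sup>2)"

lemma square_integrable_mult:
  assumes "square_integrable M u" "square_integrable M v"
  shows "integrable M (\<lambda>x. u x * v x)"
proof -
  have [measurable]: "u \<in> borel_measurable M" "v \<in> borel_measurable M"
    using assms by (auto simp: square_integrable_def)
  have "integrable M (\<lambda>x. (u x)\<^sup>2 + (v x)\<^sup>2)"
    using assms by (auto simp: square_integrable_def)
  then show ?thesis
  proof (rule Bochner_Integration.integrable_bound)
    show "AE x in M. norm (u x * v x) \<le> norm ((u x)\<^sup>2 + (v x)\<^sup>2)"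
    proof (intro AE_I2)
      fix x
      have "0 \<le> (\<bar>u x\<bar> - \<bar>v x\<bar>)\<^sup>2" by simp
      then have "2 * (\<bar>u x\<bar> * \<bar>v x\<bar>) \<le> (u x)\<^sup>2 + (v x)\<^sup>2"
        by (simp add: power2_diff algebra_simps)
      moreover have "0 \<le> \<bar>u x\<bar> * \<bar>v x\<bar>" by simp
      ultimately have "\<bar>u x\<bar> * \<bar>v x\<bar> \<le> (u x)\<^sup>2 + (v x)\<^sup>2" by linarith
      then show "norm (u x * v x) \<le> norm ((u x)\<^sup>2 + (v x)\<^sup>2)"
        by (simp add: abs_mult)
    qed
  qed simp
qed

lemma square_integrable_diff:
  assumes "square_integrable M u" "square_integrable M v"
  shows "square_integrable M (\<lambda>x. u x - v x)"
  using assms square_integrable_mult[OF assms]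
  by (auto simp: square_integrable_def power2_diff mult.assoc)

text \<open>
  By Young's inequality \<open>2 \<bar>G e\<bar> \<le> t G\<^sup>2 + e\<^sup>2 / t\<close>: the integral of the first term on the right is
  small by the choice of \<open>t\<close>, that of the second for large indices.
\<close>

lemma strong_null_product:
  fixes e :: "nat \<Rightarrow> 'b \<Rightarrow> real"
  assumes G: "square_integrable M G" and e: "\<And>n. square_integrable M (e n)"
    and lim: "(\<lambda>n. \<integral>x. (e n x)\<^sup>2 \<partial>M) \<longlonglongrightarrow> 0"
  shows "(\<lambda>n. \<integral>x. \<bar>G x * e n x\<bar> \<partial>M) \<longlonglongrightarrow> 0"
proof (rule LIMSEQ_I)
  fix c :: real assume c: "0 < c"
  define A where "A = (\<integral>x. (G x)\<^sup>2 \<partial>M)"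
  have A: "A \<ge> 0" by (simp add: A_def)
  define t where "t = c / (A + 1)"
  have t: "t > 0" "t * A < c"
    using c A by (auto simp: t_def field_simps)
  have "c * t > 0" using c t by simp
  then obtain N where N: "\<And>n. n \<ge> N \<Longrightarrow> (\<integral>x. (e n x)\<^sup>2 \<partial>M) < c * t"
    using LIMSEQ_D[OF lim] by fastforce
  have "norm ((\<integral>x. \<bar>G x * e n x\<bar> \<partial>M) - 0) < c" if "n \<ge> N" for n
  proof -
    have "(\<integral>x. \<bar>G x * e n x\<bar> \<partial>M) \<le> (\<integral>x. (t / 2) * (G x)\<^sup>2 + (1 / (2 * t)) * (e n x)\<^sup>2 \<partial>M)"
    proof (rule integral_mono)
      show "integrable M (\<lambda>x. \<bar>G x * e n x\<bar>)"
        using square_integrable_mult[OF G e] by simp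
      show "integrable M (\<lambda>x. (t / 2) * (G x)\<^sup>2 + (1 / (2 * t)) * (e n x)\<^sup>2)"
        using G e by (auto simp: square_integrable_def)
      fix x
      have "0 \<le> (t * \<bar>G x\<bar> - \<bar>e n x\<bar>)\<^sup>2" by simp
      then have "2 * t * (\<bar>G x\<bar> * \<bar>e n x\<bar>) \<le> t\<^sup>2 * (G x)\<^sup>2 + (e n x)\<^sup>2"
        by (simp add: power2_diff algebra_simps)
      then show "\<bar>G x * e n x\<bar> \<le> (t / 2) * (G x)\<^sup>2 + (1 / (2 * t)) * (e n x)\<^sup>2"
        using t by (simp add: abs_mult field_simps power2_eq_square)
    qed
    also have "\<dots> = (t / 2) * A + (1 / (2 * t)) * (\<integral>x. (e n x)\<^sup>2 \<partial>M)"
      using G e by (simp add: square_integrable_def A_def)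
    also have "\<dots> < c"
    proof -
      have "(1 / (2 * t)) * (\<integral>x. (e n x)\<^sup>2 \<partial>M) < (1 / (2 * t)) * (c * t)"
        using N[OF that] t by (intro mult_strict_left_mono) auto
      also have "\<dots> = c / 2" using t by simp
      finally show ?thesis using t by simp
    qed
    finally show ?thesis by simp
  qed
  then show "\<exists>N. \<forall>n\<ge>N. norm ((\<integral>x. \<bar>G x * e n x\<bar> \<partial>M) - 0) < c" by blast
qed

text \<open>
  By monotone convergence the sum has a finite integral, so it is finite almost everywhere.
\<close>

lemma AE_summable_of_summable_integrals:
  fixes f :: "nat \<Rightarrow> 'b \<Rightarrow> real"
  assumes f: "\<And>j. integrable M (f j)" and nn: "\<And>j x. 0 \<le> f j x"
    and sm: "summable (\<lambda>j. \<integral>x. f j x \<partial>M)"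
  shows "AE x in M. summable (\<lambda>j. f j x)"
proof -
  have [measurable]: "\<And>j. f j \<in> borel_measurable M" using f by auto
  have "(\<integral>\<^sup>+x. (\<Sum>j. ennreal (f j x)) \<partial>M) = (\<Sum>j. \<integral>\<^sup>+x. ennreal (f j x) \<partial>M)"
    by (rule nn_integral_suminf) measurable
  also have "\<dots> = (\<Sum>j. ennreal (\<integral>x. f j x \<partial>M))"
    using f nn by (simp add: nn_integral_eq_integral)
  also have "\<dots> \<noteq> \<infinity>"
    using sm nn by (simp add: ennreal_suminf_neq_top)
  finally have "AE x in M. (\<Sum>j. ennreal (f j x)) \<noteq> \<infinity>"
    by (intro nn_integral_PInf_AE) auto
  then show ?thesis
    by eventually_elim (auto intro!: summable_suminf_not_top nn)
qed

text \<open>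
  With \<open>F = \<Sum>j. 4^j e\<^sub>j\<^sup>2\<close>, which is integrable by the assumed decay, the Cauchy-Schwarz inequality
  with the weights \<open>2^(-j)\<close> and \<open>2^j\<close> gives the pointwise bound \<open>(\<Sum>j. \<bar>e\<^sub>j\<bar>)\<^sup>2 \<le> 2 F\<close>.
\<close>

lemma square_integrable_rapid_series:
  fixes e :: "nat \<Rightarrow> 'b \<Rightarrow> real"
  assumes e: "\<And>j. square_integrable M (e j)"
    and small: "\<And>j. (\<integral>x. (e j x)\<^sup>2 \<partial>M) \<le> (1/8) ^ j"
  shows "AE x in M. summable (\<lambda>j. \<bar>e j x\<bar>)"
    and "square_integrable M (\<lambda>x. \<Sum>j. e j x)"
proof -
  have [measurable]: "\<And>j. e j \<in> borel_measurable M"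
    using e by (auto simp: square_integrable_def)
  \<comment> \<open>The factor \<open>4^j\<close> is affordable, as the integrals of \<open>e\<^sub>j\<^sup>2\<close> decay like \<open>8^(-j)\<close>.\<close>
  define f where "f = (\<lambda>j x. 4 ^ j * (e j x)\<^sup>2)"
  define F where "F = (\<lambda>x. \<Sum>j. f j x)"
  have f: "\<And>j. integrable M (f j)" "\<And>j x. 0 \<le> f j x"
    using e by (auto simp: f_def square_integrable_def)
  have "(\<integral>x. f j x \<partial>M) \<le> (1/2) ^ j" for j
  proof -
    have "(\<integral>x. f j x \<partial>M) \<le> 4 ^ j * (1/8) ^ j"
      using small[of j] by (simp add: f_def)
    also have "\<dots> = (1/2) ^ j" by (simp add: power_mult_distrib[symmetric])
    finally show ?thesis .
  qed
  then have le: "norm (\<integral>x. f j x \<partial>M) \<le> (1/2) ^ j" for j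
    using f(2) by (simp add: integral_nonneg)
  have geo: "summable (\<lambda>j. (1/2::real) ^ j)" by (rule summable_geometric) simp
  have sm: "summable (\<lambda>j. \<integral>x. f j x \<partial>M)"
    by (rule summable_comparison_test'[OF geo le])
  have AEf: "AE x in M. summable (\<lambda>j. f j x)"
    by (rule AE_summable_of_summable_integrals[OF f sm])
  have F: "integrable M F"
    unfolding F_def using f AEf sm by (intro integrable_suminf) auto
  have key: "summable (\<lambda>j. \<bar>e j x\<bar>) \<and> (\<Sum>j. \<bar>e j x\<bar>)\<^sup>2 \<le> 2 * F x"
    if S: "summable (\<lambda>j. f j x)" for x
  proof -
    have part: "(\<Sum>j<m. \<bar>e j x\<bar>)\<^sup>2 \<le> 2 * F x" for m
    proof -
      have "(\<Sum>j<m. \<bar>e j x\<bar>) = (\<Sum>j<m. (1/2)^j * (2^j * \<bar>e j x\<bar>))"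
        by (simp add: power_divide)
      then have "(\<Sum>j<m. \<bar>e j x\<bar>)\<^sup>2 \<le> (\<Sum>j<m. ((1/2)^j)\<^sup>2) * (\<Sum>j<m. (2^j * \<bar>e j x\<bar>)\<^sup>2)"
        using Cauchy_Schwarz_ineq_sum[of "\<lambda>j. (1/2)^j" "\<lambda>j. 2^j * \<bar>e j x\<bar>" "{..<m}"] by simp
      also have "\<dots> \<le> 2 * F x"
      proof (rule mult_mono)
        have "(\<Sum>j<m. ((1/2::real)^j)\<^sup>2) = (\<Sum>j<m. (1/4)^j)"
          by (simp add: power2_eq_square power_mult_distrib[symmetric])
        also have "\<dots> \<le> (\<Sum>j. (1/4)^j)"
          by (intro sum_le_suminf) (auto simp: summable_geometric)
        also have "\<dots> \<le> 2" by (simp add: suminf_geometric)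
        finally show "(\<Sum>j<m. ((1/2::real)^j)\<^sup>2) \<le> 2" .
        have "(2 ^ j * \<bar>e j x\<bar>)\<^sup>2 = f j x" for j
        proof -
          have "((2::real) ^ j)\<^sup>2 = 4 ^ j"
            by (simp add: power2_eq_square power_mult_distrib[symmetric])
          then show ?thesis by (simp add: f_def power_mult_distrib)
        qed
        then show "(\<Sum>j<m. (2^j * \<bar>e j x\<bar>)\<^sup>2) \<le> F x"
          unfolding F_def using S f(2) by (simp add: sum_le_suminf)
      qed (auto intro!: sum_nonneg)
      finally show ?thesis .
    qed
    have Fnn: "0 \<le> F x" unfolding F_def using S f(2) by (rule suminf_nonneg)
    have "(\<Sum>j<m. \<bar>e j x\<bar>) \<le> sqrt (2 * F x)" for m
      using part by (rule real_le_rsqrt)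
    then have *: "summable (\<lambda>j. \<bar>e j x\<bar>)" 
      by (intro summableI_nonneg_bounded) auto
    then have "(\<lambda>m. (\<Sum>j<m. \<bar>e j x\<bar>)\<^sup>2) \<longlonglongrightarrow> (\<Sum>j. \<bar>e j x\<bar>)\<^sup>2"
      by (intro tendsto_power summable_LIMSEQ)
    then have "(\<Sum>j. \<bar>e j x\<bar>)\<^sup>2 \<le> 2 * F x"
      by (rule LIMSEQ_le_const2) (use part in blast)
    with * show ?thesis ..
  qed
  show "AE x in M. summable (\<lambda>j. \<bar>e j x\<bar>)"
    using AEf by eventually_elim (use key in blast)
  have "integrable M (\<lambda>x. (\<Sum>j. e j x)\<^sup>2)"
  proof (rule Bochner_Integration.integrable_bound[of M "\<lambda>x. 2 * F x"])
    show "AE x in M. norm ((\<Sum>j. e j x)\<^sup>2) \<le> norm (2 * F x)"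
      using AEf
    proof eventually_elim
      case (elim x)
      have "\<bar>\<Sum>j. e j x\<bar> \<le> (\<Sum>j. \<bar>e j x\<bar>)"
        using key[OF elim] by (intro summable_rabs) auto
      then have "\<bar>\<Sum>j. e j x\<bar>\<^sup>2 \<le> (\<Sum>j. \<bar>e j x\<bar>)\<^sup>2" by (intro power_mono) auto
      with key[OF elim] have "(\<Sum>j. e j x)\<^sup>2 \<le> 2 * F x" by (simp del: power_mono_iff)
      then show ?case by (simp add: abs_le_iff order_trans[OF _ abs_ge_self])
    qed
  qed (use F in auto)
  then show "square_integrable M (\<lambda>x. \<Sum>j. e j x)"
    by (simp add: square_integrable_def)
qed

text \<open>
  A gliding hump argument, as in the proof of the uniform boundedness principle.  If the products
  do not tend to zero, a subsequence \<open>f\<close> is chosen along which they stay above some \<open>\<epsilon>\<close> in absolute value, while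
  all the mixed products of \<open>G (f k)\<close> and \<open>e (f j)\<close> with \<open>j \<noteq> k\<close> are at most \<open>c j\<close>, where the
  \<open>c j\<close> sum up to \<open>\<epsilon> / 2\<close>.  For \<open>j < k\<close> this is achieved by the weak convergence of \<open>G\<close>, for
  \<open>j > k\<close> by the strong convergence of \<open>e\<close>.  The sum \<open>h\<close> of the \<open>e (f j)\<close> is then a single test
  function against which \<open>G (f k)\<close> does not tend to zero.
\<close>

lemma weak_null_strong_null_product:
  fixes G e :: "nat \<Rightarrow> 'b \<Rightarrow> real"
  assumes G: "\<And>n. square_integrable M (G n)" and e: "\<And>n. square_integrable M (e n)"
    and weak: "\<And>h. square_integrable M h \<Longrightarrow> (\<lambda>n. \<integral>x. G n x * h x \<partial>M) \<longlonglongrightarrow> 0"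
    and strong: "(\<lambda>n. \<integral>x. (e n x)\<^sup>2 \<partial>M) \<longlonglongrightarrow> 0"
  shows "(\<lambda>n. \<integral>x. G n x * e n x \<partial>M) \<longlonglongrightarrow> 0"
proof (rule ccontr)
  assume "\<not> ?thesis"
  then obtain \<epsilon> where \<epsilon>: "\<epsilon> > 0" "\<And>N. \<exists>n\<ge>N. \<epsilon> \<le> \<bar>\<integral>x. G n x * e n x \<partial>M\<bar>"
    unfolding LIMSEQ_def by (auto simp: not_less)
  define c where "c = (\<lambda>j. \<epsilon> / 4 * (1/2::real) ^ j)"
  have c: "c j > 0" for j using \<epsilon> by (simp add: c_def)
  \<comment> \<open>\<open>P f k n\<close>: \<open>n\<close> is suitable as the \<open>k\<close>-th index of the subsequence with earlier indices \<open>f j\<close>.\<close>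
  define P where "P = (\<lambda>f k n. \<epsilon> \<le> \<bar>\<integral>x. G n x * e n x \<partial>M\<bar> \<and> (\<integral>x. (e n x)\<^sup>2 \<partial>M) \<le> (1/8) ^ k \<and>
     (\<forall>j<k. f j < n \<and> \<bar>\<integral>x. G n x * e (f j) x \<partial>M\<bar> \<le> c j \<and> (\<integral>x. \<bar>G (f j) x * e n x\<bar> \<partial>M) \<le> c k))"
  have "\<exists>f. \<forall>k::nat. P f k (f k)"
  proof (rule dependent_wellorder_choice)
    fix r and f g :: "nat \<Rightarrow> nat" and x :: nat
    assume "\<And>y. y < x \<Longrightarrow> f y = g y"
    then show "P f x r = P g x r" unfolding P_def by auto
  next
    fix k f
    have "\<forall>\<^sub>F n in sequentially. \<forall>j\<in>{..<k}. f j < n \<and> \<bar>\<integral>x. G n x * e (f j) x \<partial>M\<bar> \<le> c j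
            \<and> (\<integral>x. \<bar>G (f j) x * e n x\<bar> \<partial>M) \<le> c k"
    proof (intro eventually_ball_finite ballI eventually_conj)
      fix j
      show "\<forall>\<^sub>F n in sequentially. f j < n" by (rule eventually_gt_at_top)
      have "(\<lambda>n. \<bar>\<integral>x. G n x * e (f j) x \<partial>M\<bar>) \<longlonglongrightarrow> 0"
        using weak[OF e] by (simp add: tendsto_rabs_zero_iff)
      from order_tendstoD(2)[OF this c[of j]]
      show "\<forall>\<^sub>F n in sequentially. \<bar>\<integral>x. G n x * e (f j) x \<partial>M\<bar> \<le> c j"
        by eventually_elim simp
      from order_tendstoD(2)[OF strong_null_product[OF G e strong] c[of k], of "f j"]
      show "\<forall>\<^sub>F n in sequentially. (\<integral>x. \<bar>G (f j) x * e n x\<bar> \<partial>M) \<le> c k"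
        by eventually_elim simp
    qed simp
    moreover have "\<forall>\<^sub>F n in sequentially. (\<integral>x. (e n x)\<^sup>2 \<partial>M) \<le> (1/8) ^ k"
      using order_tendstoD(2)[OF strong, of "(1/8)^k"] by (auto elim: eventually_mono)
    ultimately have "\<forall>\<^sub>F n in sequentially. (\<integral>x. (e n x)\<^sup>2 \<partial>M) \<le> (1/8) ^ k \<and>
       (\<forall>j\<in>{..<k}. f j < n \<and> \<bar>\<integral>x. G n x * e (f j) x \<partial>M\<bar> \<le> c j
            \<and> (\<integral>x. \<bar>G (f j) x * e n x\<bar> \<partial>M) \<le> c k)"
      by eventually_elim blast
    then obtain N where "\<And>n. n \<ge> N \<Longrightarrow> (\<integral>x. (e n x)\<^sup>2 \<partial>M) \<le> (1/8) ^ k \<and>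
       (\<forall>j\<in>{..<k}. f j < n \<and> \<bar>\<integral>x. G n x * e (f j) x \<partial>M\<bar> \<le> c j
            \<and> (\<integral>x. \<bar>G (f j) x * e n x\<bar> \<partial>M) \<le> c k)"
      unfolding eventually_sequentially by blast
    with \<epsilon>(2)[of N] show "\<exists>n. P f k n" unfolding P_def by auto
  qed
  then obtain f where f: "\<And>k. P f k (f k)" by blast
  have big: "\<epsilon> \<le> \<bar>\<integral>x. G (f k) x * e (f k) x \<partial>M\<bar>"
    and small: "(\<integral>x. (e (f k) x)\<^sup>2 \<partial>M) \<le> (1/8) ^ k" for k
    using f[of k] by (auto simp: P_def)
  have mono: "strict_mono f"
    using f by (intro strict_monoI_Suc) (auto simp: P_def)
  have absint: "(\<integral>x. \<bar>G (f k) x * e (f j) x\<bar> \<partial>M) \<le> c j" if "k < j" for k j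
    using f[of j] that by (auto simp: P_def)
  have off: "\<bar>\<integral>x. G (f k) x * e (f j) x \<partial>M\<bar> \<le> c j" if "j \<noteq> k" for k j
  proof (cases "j < k")
    case True then show ?thesis using f[of k] by (auto simp: P_def)
  next
    case False
    with that have "(\<integral>x. \<bar>G (f k) x * e (f j) x\<bar> \<partial>M) \<le> c j" by (intro absint) simp
    then show ?thesis
      by (rule order_trans[OF integral_abs_bound])
  qed
  define h where "h = (\<lambda>x. \<Sum>j. e (f j) x)"
  have h: "square_integrable M h" and AEs: "AE x in M. summable (\<lambda>j. \<bar>e (f j) x\<bar>)"
    unfolding h_def using square_integrable_rapid_series[of M "\<lambda>j. e (f j)"] e small by auto
  have csum: "c sums (\<epsilon> / 2)"
    using sums_mult[OF geometric_sums[of "1/2::real"], of "\<epsilon> / 4"] by (simp add: c_def)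
  have lower: "\<epsilon> / 2 \<le> \<bar>\<integral>x. G (f k) x * h x \<partial>M\<bar>" for k
  proof -
    have int: "integrable M (\<lambda>x. G (f k) x * e (f j) x)" for j
      by (rule square_integrable_mult[OF G e])
    have s1: "AE x in M. summable (\<lambda>j. norm (G (f k) x * e (f j) x))"
      using AEs by eventually_elim (simp add: abs_mult summable_mult)
    have s2: "summable (\<lambda>j. \<integral>x. norm (G (f k) x * e (f j) x) \<partial>M)"
      by (rule summable_comparison_test'[OF sums_summable[OF csum], of "Suc k"])
        (use absint[of k] in simp)
    have "AE x in M. G (f k) x * h x = (\<Sum>j. G (f k) x * e (f j) x)"
      using AEs
    proof eventually_elim
      case (elim x)
      show ?case
        unfolding h_def by (rule suminf_mult[OF summable_rabs_cancel[OF elim], symmetric])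
    qed
    moreover have [measurable]: "h \<in> borel_measurable M" "\<And>n. e n \<in> borel_measurable M"
      "\<And>n. G n \<in> borel_measurable M"
      using e h G by (auto simp: square_integrable_def)
    ultimately have "(\<integral>x. G (f k) x * h x \<partial>M) = (\<integral>x. (\<Sum>j. G (f k) x * e (f j) x) \<partial>M)"
      by (intro integral_cong_AE) auto
    also have "\<dots> = (\<Sum>j. \<integral>x. G (f k) x * e (f j) x \<partial>M)"
      by (rule integral_suminf[OF int s1 s2])
    finally have eq: "(\<integral>x. G (f k) x * h x \<partial>M) = (\<Sum>j. \<integral>x. G (f k) x * e (f j) x \<partial>M)" .
    define a where "a = (\<lambda>j. \<integral>x. G (f k) x * e (f j) x \<partial>M)"
    have sa: "summable a"
      unfolding a_def by (rule summable_integral[OF int s1 s2])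
    \<comment> \<open>The diagonal term is removed from the series; what remains is bounded by \<open>\<epsilon> / 2\<close>.\<close>
    define a' where "a' = (\<lambda>j. if j = k then 0 else a j)"
    have ak: "(\<lambda>j. if j = k then a j else 0) sums a k"
      by (rule sums_single)
    have *: "(\<lambda>j. a j - (if j = k then a j else 0)) sums (suminf a - a k)"
      by (rule sums_diff[OF summable_sums[OF sa] ak])
    then have a': "a' sums (suminf a - a k)"
    proof -
      have "(\<lambda>j. a j - (if j = k then a j else 0)) = a'" by (auto simp: a'_def fun_eq_iff)
      then show ?thesis using * by simp
    qed
    have bnd: "norm (a' j) \<le> c j" for j
      using off[of j k] c[of j] by (auto simp: a'_def a_def)
    have "norm (suminf a') \<le> suminf c"
      by (rule norm_suminf_le[OF bnd sums_summable[OF csum]])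
    then have "\<bar>suminf a - a k\<bar> \<le> \<epsilon> / 2"
      using a' csum by (simp add: sums_unique[symmetric])
    moreover have "\<epsilon> \<le> \<bar>a k\<bar>" using big[of k] by (simp add: a_def)
    ultimately show ?thesis
      unfolding eq a_def[symmetric] by linarith
  qed
  have "(\<lambda>k. \<bar>\<integral>x. G (f k) x * h x \<partial>M\<bar>) \<longlonglongrightarrow> 0"
    using LIMSEQ_subseq_LIMSEQ[OF weak[OF h] mono] by (simp add: tendsto_rabs_zero_iff o_def)
  then have "\<epsilon> / 2 \<le> 0"
    by (rule LIMSEQ_le_const) (use lower in blast)
  with \<epsilon>(1) show False by simp
qed

text \<open>
  Both factors are centred at their limits: the product of the two differences tends to zero by
  the gliding hump argument, the two mixed terms by strong and weak convergence, respectively.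
\<close>

lemma weak_strong_product:
  fixes G e :: "nat \<Rightarrow> 'b \<Rightarrow> real"
  assumes G: "\<And>n. square_integrable M (G n)" "square_integrable M G0"
    and e: "\<And>n. square_integrable M (e n)" "square_integrable M e0"
    and weak: "\<And>h. square_integrable M h \<Longrightarrow>
      (\<lambda>n. \<integral>x. G n x * h x \<partial>M) \<longlonglongrightarrow> (\<integral>x. G0 x * h x \<partial>M)"
    and strong: "(\<lambda>n. \<integral>x. (e n x - e0 x)\<^sup>2 \<partial>M) \<longlonglongrightarrow> 0"
  shows "(\<lambda>n. \<integral>x. G n x * e n x \<partial>M) \<longlonglongrightarrow> (\<integral>x. G0 x * e0 x \<partial>M)"
proof -
  note I = square_integrable_mult
  have d: "square_integrable M (\<lambda>x. G n x - G0 x)" "square_integrable M (\<lambda>x. e n x - e0 x)" for n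
    using G e by (auto intro: square_integrable_diff)
  have w0: "(\<lambda>n. \<integral>x. (G n x - G0 x) * h x \<partial>M) \<longlonglongrightarrow> 0" if "square_integrable M h" for h
    using tendsto_diff[OF weak[OF that] tendsto_const[of "\<integral>x. G0 x * h x \<partial>M"]] G that
    by (simp add: I left_diff_distrib)
  have 1: "(\<lambda>n. \<integral>x. (G n x - G0 x) * (e n x - e0 x) \<partial>M) \<longlonglongrightarrow> 0"
    by (rule weak_null_strong_null_product[OF d w0 strong])
  have "(\<lambda>n. \<bar>\<integral>x. G0 x * (e n x - e0 x) \<partial>M\<bar>) \<longlonglongrightarrow> 0"
    by (rule tendsto_sandwich[OF _ _ tendsto_const strong_null_product[OF G(2) d(2) strong]])
       (auto intro!: always_eventually)
  then have 2: "(\<lambda>n. \<integral>x. G0 x * (e n x - e0 x) \<partial>M) \<longlonglongrightarrow> 0"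
    by (simp add: tendsto_rabs_zero_iff)
  have "(\<lambda>n. (\<integral>x. (G n x - G0 x) * (e n x - e0 x) \<partial>M) + (\<integral>x. G0 x * (e n x - e0 x) \<partial>M)
      + (\<integral>x. G n x * e0 x \<partial>M)) \<longlonglongrightarrow> 0 + 0 + (\<integral>x. G0 x * e0 x \<partial>M)"
    by (intro tendsto_add 1 2 weak e)
  moreover have "(\<integral>x. (G n x - G0 x) * (e n x - e0 x) \<partial>M) + (\<integral>x. G0 x * (e n x - e0 x) \<partial>M)
      + (\<integral>x. G n x * e0 x \<partial>M) = (\<integral>x. G n x * e n x \<partial>M)" for n
  proof -
    have "(\<integral>x. (G n x - G0 x) * (e n x - e0 x) \<partial>M) + (\<integral>x. G0 x * (e n x - e0 x) \<partial>M)
      + (\<integral>x. G n x * e0 x \<partial>M) = (\<integral>x. (G n x - G0 x) * (e n x - e0 x) + G0 x * (e n x - e0 x)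
      + G n x * e0 x \<partial>M)"
      by (simp add: I d G e)
    also have "\<dots> = (\<integral>x. G n x * e n x \<partial>M)"
      by (intro Bochner_Integration.integral_cong) (auto simp: algebra_simps)
    finally show ?thesis .
  qed
  ultimately show ?thesis by simp
qed

section \<open>The divergence of a compactly supported field\<close>

lemma has_derivative_zero_outside_support:
  fixes f :: "'a::real_normed_vector \<Rightarrow> 'b::real_normed_vector"
  assumes "x \<notin> closure {x. f x \<noteq> 0}"
  shows "(f has_derivative (\<lambda>_. 0)) (at x)"
proof -
  have "((\<lambda>_. 0) has_derivative (\<lambda>_. 0)) (at x)" by simp
  then show ?thesis
  proof (rule has_derivative_transform_within_open)
    show "open (- closure {x. f x \<noteq> 0})" by (rule open_Compl) simp
    show "x \<in> - closure {x. f x \<noteq> 0}" using assms by simp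
    show "0 = f y" if "y \<in> - closure {x. f x \<noteq> 0}" for y
      using that closure_subset by force
  qed
qed

text \<open>
  By translation invariance every difference quotient of \<open>f\<close> in the direction \<open>h\<close> has integral
  zero.  The mean value theorem bounds the quotients uniformly on a fixed ball outside of which
  they vanish, so the dominated convergence theorem passes to the derivative.
\<close>

lemma integral_directional_derivative_eq_0:
  fixes f :: "'a::euclidean_space \<Rightarrow> real"
  assumes der: "\<And>x. (f has_derivative D x) (at x)"
    and cont: "continuous_on UNIV (\<lambda>x. D x h)"
    and S: "compact S" and f0: "\<And>x. x \<notin> S \<Longrightarrow> f x = 0"
  shows "(\<integral>x. D x h \<partial>lborel) = 0"
proof -
  have contf: "continuous_on UNIV f"
    using der by (intro has_derivative_continuous_on) (auto intro: has_derivative_at_withinI)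
  then have mf [measurable]: "f \<in> borel_measurable borel"
    by (rule borel_measurable_continuous_onI)
  have mD [measurable]: "(\<lambda>x. D x h) \<in> borel_measurable borel"
    using cont by (rule borel_measurable_continuous_onI)
  have sub: "closure {x. f x \<noteq> 0} \<subseteq> S"
    using f0 compact_imp_closed[OF S] by (intro closure_minimal) auto
  have D0: "D x h = 0" if "x \<notin> S" for x
  proof -
    have "x \<notin> closure {x. f x \<noteq> 0}" using that sub by blast
    from has_derivative_unique[OF der has_derivative_zero_outside_support[OF this]]
    show ?thesis by simp
  qed
  have "bounded ((\<lambda>x. D x h) ` S)"
    using S continuous_on_subset[OF cont] by (intro compact_imp_bounded compact_continuous_image) auto
  then obtain M where M: "0 < M" "\<And>x. x \<in> S \<Longrightarrow> \<bar>D x h\<bar> \<le> M"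
    unfolding bounded_pos by auto
  have M': "\<bar>D x h\<bar> \<le> M" for x
    using M D0[of x] by (cases "x \<in> S") auto
  obtain R where R: "S \<subseteq> ball 0 R"
    using compact_imp_bounded[OF S] bounded_subset_ballD by blast
  \<comment> \<open>All the steps \<open>h / (n + 1)\<close> have length at most \<open>norm h\<close>.\<close>
  define K where "K = cball (0::'a) (R + norm h)"
  define q where "q = (\<lambda>n x. real (Suc n) * (f (x + (1 / real (Suc n)) *\<^sub>R h) - f x))"
  have quotient: "\<exists>y. q n x = D y h" for n x
  proof -
    let ?s = "1 / real (Suc n)"
    have "\<exists>t\<in>{0..?s}. f (x + ?s *\<^sub>R h) - f (x + 0 *\<^sub>R h) = D (x + t *\<^sub>R h) ((?s - 0) *\<^sub>R h)"
    proof (rule mvt_very_simple[where f = "\<lambda>t. f (x + t *\<^sub>R h)" and f' = "\<lambda>t u. D (x + t *\<^sub>R h) (u *\<^sub>R h)"])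
      fix t
      have "((\<lambda>t. x + t *\<^sub>R h) has_derivative (\<lambda>u. u *\<^sub>R h)) (at t within {0..?s})"
        by (auto intro!: derivative_eq_intros)
      from has_derivative_compose[OF this der]
      show "((\<lambda>t. f (x + t *\<^sub>R h)) has_derivative (\<lambda>u. D (x + t *\<^sub>R h) (u *\<^sub>R h))) (at t within {0..?s})" .
    qed simp
    then obtain t where "f (x + ?s *\<^sub>R h) - f x = D (x + t *\<^sub>R h) (?s *\<^sub>R h)" by auto
    also have "\<dots> = ?s * D (x + t *\<^sub>R h) h"
      using linear_scale[OF has_derivative_linear[OF der]] by simp
    finally show ?thesis by (auto simp: q_def)
  qed
  have q0: "q n x = 0" if "x \<notin> K" for n x
  proof -
    have *: "f y = 0" if "norm (y - x) \<le> norm h" for y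
    proof -
      have "norm x \<le> norm y + norm (y - x)" by norm
      then have "y \<notin> ball 0 R" using \<open>x \<notin> K\<close> that by (auto simp: K_def)
      then show ?thesis using R f0 by blast
    qed
    have "norm ((1 / real (Suc n)) *\<^sub>R h) \<le> norm h"
      by (simp add: field_simps mult_left_le_one_le)
    then show ?thesis by (auto simp: q_def *)
  qed
  have intf: "integrable lborel f"
  proof -
    have "integrable lborel (\<lambda>x. indicator S x *\<^sub>R f x)"
      by (rule borel_integrable_compact[OF S]) (use contf continuous_on_subset in blast)
    also have "(\<lambda>x. indicator S x *\<^sub>R f x) = f"
      using f0 by (fastforce simp: indicator_def fun_eq_iff)
    finally show ?thesis .
  qed
  have shift: "integrable lborel (\<lambda>x. f (x + c))" "(\<integral>x. f (x + c) \<partial>lborel) = (\<integral>x. f x \<partial>lborel)" for c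
  proof -
    have d: "distr lborel borel ((+) c) = (lborel :: 'a measure)" by (rule lborel_distr_plus)
    show "integrable lborel (\<lambda>x. f (x + c))"
      using intf integrable_distr_eq[of "(+) c" lborel borel f] d by (simp add: add.commute)
    show "(\<integral>x. f (x + c) \<partial>lborel) = (\<integral>x. f x \<partial>lborel)"
      using integral_distr[of "(+) c" lborel borel f] d by (simp add: add.commute)
  qed
  have int0: "(\<integral>x. q n x \<partial>lborel) = 0" for n
    using shift intf by (simp add: q_def)
  have "(\<lambda>n. \<integral>x. q n x \<partial>lborel) \<longlonglongrightarrow> (\<integral>x. D x h \<partial>lborel)"
  proof (rule integral_dominated_convergence[where w = "\<lambda>x. M * indicator K x"])
    have "emeasure lborel K < \<infinity>" unfolding K_def by (rule emeasure_lborel_cball_finite)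
    then show "integrable lborel (\<lambda>x. M * indicator K x)"
      by (simp add: K_def)
    show "AE x in lborel. (\<lambda>n. q n x) \<longlonglongrightarrow> D x h"
    proof (intro AE_I2)
      fix x
      have "((\<lambda>t. x + t *\<^sub>R h) has_derivative (\<lambda>u. u *\<^sub>R h)) (at 0)"
        by (auto intro!: derivative_eq_intros)
      moreover have "(f has_derivative D x) (at (x + 0 *\<^sub>R h))" using der by simp
      ultimately have "((\<lambda>t. f (x + t *\<^sub>R h)) has_derivative (\<lambda>u. D x (u *\<^sub>R h))) (at 0)"
        by (rule has_derivative_compose)
      then have "((\<lambda>t. f (x + t *\<^sub>R h)) has_derivative (\<lambda>u. D x h * u)) (at 0)"
        using linear_scale[OF has_derivative_linear[OF der]] by (simp add: mult.commute)
      then have "((\<lambda>t. f (x + t *\<^sub>R h)) has_field_derivative D x h) (at 0)"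
        by (simp add: has_field_derivative_def)
      then have lim: "((\<lambda>t. (f (x + t *\<^sub>R h) - f x) / t) \<longlongrightarrow> D x h) (at 0)"
        by (simp add: has_field_derivative_iff)
      have "filterlim (\<lambda>n. 1 / real (Suc n)) (at 0) sequentially"
        unfolding filterlim_at using LIMSEQ_inverse_real_of_nat by (simp add: inverse_eq_divide)
      from filterlim_compose[OF lim this]
      show "(\<lambda>n. q n x) \<longlonglongrightarrow> D x h" by (simp add: q_def mult.commute)
    qed
    show "AE x in lborel. norm (q n x) \<le> M * indicator K x" for n
    proof (intro AE_I2)
      fix x
      show "norm (q n x) \<le> M * indicator K x"
        using quotient[of n x] q0[of x n] M' by (cases "x \<in> K") auto
    qed
  qed (auto simp: q_def)
  then show ?thesis
    unfolding int0 by (rule LIMSEQ_unique) (rule tendsto_const)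
qed

lemma divergence_eq:
  assumes "(\<phi> has_derivative D) (at x)"
  shows "divergence \<phi> x = (\<Sum>b\<in>Basis. D b \<bullet> b)"
  using frechet_derivative_at[OF assms] by (simp add: divergence_def)

lemma C1c_fields_has_derivative:
  assumes "\<phi> \<in> C1c_fields \<Omega>"
  shows "(\<phi> has_derivative frechet_derivative \<phi> (at x)) (at x)"
  using assms by (simp add: C1c_fields_def frechet_derivative_works[symmetric])

lemma C1c_fields_support:
  assumes "\<phi> \<in> C1c_fields \<Omega>"
  shows "compact (closure {x. \<phi> x \<noteq> 0})" "closure {x. \<phi> x \<noteq> 0} \<subseteq> \<Omega>"
  using assms by (auto simp: C1c_fields_def)

lemma divergence_outside_support:
  assumes "x \<notin> closure {x. \<phi> x \<noteq> 0}"
  shows "divergence \<phi> x = 0"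
  using divergence_eq[OF has_derivative_zero_outside_support[OF assms]] by simp

lemma continuous_divergence:
  assumes "\<phi> \<in> C1c_fields \<Omega>"
  shows "continuous_on UNIV (divergence \<phi>)"
  unfolding divergence_def[abs_def] using assms
  by (intro continuous_intros) (auto simp: C1c_fields_def)

lemma divergence_bounded:
  assumes "\<phi> \<in> C1c_fields \<Omega>"
  obtains M where "0 < M" "\<And>x. \<bar>divergence \<phi> x\<bar> \<le> M"
proof -
  let ?S = "closure {x. \<phi> x \<noteq> 0}"
  have "bounded (divergence \<phi> ` ?S)"
    using C1c_fields_support(1)[OF assms] continuous_on_subset[OF continuous_divergence[OF assms]]
    by (intro compact_imp_bounded compact_continuous_image) auto
  then obtain M where M: "0 < M" "\<And>x. x \<in> ?S \<Longrightarrow> \<bar>divergence \<phi> x\<bar> \<le> M"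
    unfolding bounded_pos by auto
  have "\<bar>divergence \<phi> x\<bar> \<le> M" for x
    using M divergence_outside_support[of x \<phi>] by (cases "x \<in> ?S") auto
  with M that show ?thesis by blast
qed

lemma borel_measurable_divergence:
  assumes "\<phi> \<in> C1c_fields \<Omega>"
  shows "divergence \<phi> \<in> borel_measurable (lebesgue_on S)"
  using borel_measurable_continuous_onI[OF continuous_divergence[OF assms]]
  by (intro measurable_restrict_space1 measurable_completion) (simp add: measurable_lborel1)

lemma integrable_mult_divergence:
  assumes "integrable (lebesgue_on S) u" and "\<phi> \<in> C1c_fields \<Omega>"
  shows "integrable (lebesgue_on S) (\<lambda>x. u x * divergence \<phi> x)"
proof -
  obtain M where M: "0 < M" "\<And>x. \<bar>divergence \<phi> x\<bar> \<le> M"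
    using divergence_bounded[OF assms(2)] by blast
  have "integrable (lebesgue_on S) (\<lambda>x. u x * M)" using assms by simp
  then show ?thesis
  proof (rule Bochner_Integration.integrable_bound)
    show "AE x in lebesgue_on S. norm (u x * divergence \<phi> x) \<le> norm (u x * M)"
      using M by (intro AE_I2) (simp add: abs_mult mult_left_mono)
    have "u \<in> borel_measurable (lebesgue_on S)" using assms(1) by simp
    then show "(\<lambda>x. u x * divergence \<phi> x) \<in> borel_measurable (lebesgue_on S)"
      using borel_measurable_divergence[OF assms(2)] by (rule borel_measurable_times)
  qed
qed

text \<open>
  The support of \<open>\<phi>\<close> lies in \<open>\<Omega>\<close>, so the integral extends to the whole space, where each summand of
  the divergence is a directional derivative of a compactly supported function.
\<close>

lemma integral_divergence_eq_0:
  assumes \<Omega>: "\<Omega> \<in> sets lebesgue" and \<phi>: "\<phi> \<in> C1c_fields \<Omega>"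
  shows "(LINT x|lebesgue_on \<Omega>. divergence \<phi> x) = 0"
proof -
  let ?S = "closure {x. \<phi> x \<noteq> 0}"
  let ?D = "\<lambda>x. frechet_derivative \<phi> (at x)"
  have S: "compact ?S" "?S \<subseteq> \<Omega>" using C1c_fields_support[OF \<phi>] by auto
  have contD: "continuous_on UNIV (\<lambda>x. ?D x b \<bullet> b)" for b
    using \<phi> by (intro continuous_intros) (auto simp: C1c_fields_def)
  have D0: "?D x b = 0" if "x \<notin> ?S" for x b
    using frechet_derivative_at[OF has_derivative_zero_outside_support[OF that]]
    by (simp add: fun_eq_iff)
  have int: "integrable lborel (\<lambda>x. ?D x b \<bullet> b)" for b
  proof -
    have "integrable lborel (\<lambda>x. indicator ?S x *\<^sub>R (?D x b \<bullet> b))"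
      by (rule borel_integrable_compact[OF S(1)]) (use contD continuous_on_subset in blast)
    also have "(\<lambda>x. indicator ?S x *\<^sub>R (?D x b \<bullet> b)) = (\<lambda>x. ?D x b \<bullet> b)"
      using D0 by (auto simp: indicator_def fun_eq_iff)
    finally show ?thesis .
  qed
  have zero: "(\<integral>x. ?D x b \<bullet> b \<partial>lborel) = 0" for b
  proof (rule integral_directional_derivative_eq_0[OF _ _ S(1), where f = "\<lambda>x. \<phi> x \<bullet> b" and D = "\<lambda>x h. ?D x h \<bullet> b"])
    show "((\<lambda>x. \<phi> x \<bullet> b) has_derivative (\<lambda>h. ?D x h \<bullet> b)) (at x)" for x
      by (rule has_derivative_inner_left[OF C1c_fields_has_derivative[OF \<phi>]])
    show "\<phi> x \<bullet> b = 0" if "x \<notin> ?S" for x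
    proof -
      have "\<phi> x = 0" using that closure_subset[of "{x. \<phi> x \<noteq> 0}"] by auto
      then show ?thesis by simp
    qed
  qed (rule contD)
  have "(LINT x|lebesgue_on \<Omega>. divergence \<phi> x) = (LINT x|lebesgue. indicator \<Omega> x *\<^sub>R divergence \<phi> x)"
    using \<Omega> by (simp add: integral_restrict_space)
  also have "\<dots> = (LINT x|lebesgue. divergence \<phi> x)"
    using divergence_outside_support S(2)
    by (intro Bochner_Integration.integral_cong) (auto simp: indicator_def)
  also have "\<dots> = (LINT x|lborel. divergence \<phi> x)"
    using borel_measurable_continuous_onI[OF continuous_divergence[OF \<phi>]]
    by (intro integral_completion) (simp add: measurable_lborel1)
  also have "\<dots> = (\<Sum>b\<in>Basis. \<integral>x. ?D x b \<bullet> b \<partial>lborel)"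
    unfolding divergence_def using int by (intro Bochner_Integration.integral_sum) auto
  also have "\<dots> = 0" using zero by simp
  finally show ?thesis .
qed

lemma cutoff_field:
  assumes \<phi>: "\<phi> \<in> C1c_fields \<Omega>"
    and der: "\<And>x. (\<eta> has_derivative E x) (at x)"
    and cont: "\<And>h. continuous_on UNIV (\<lambda>x. E x h)"
  shows "(\<lambda>x. \<eta> x *\<^sub>R \<phi> x) \<in> C1c_fields \<Omega>"
    and "divergence (\<lambda>x. \<eta> x *\<^sub>R \<phi> x) x = \<eta> x * divergence \<phi> x + E x (\<phi> x)"
proof -
  let ?D = "\<lambda>x. frechet_derivative \<phi> (at x)"
  have d: "((\<lambda>x. \<eta> x *\<^sub>R \<phi> x) has_derivative (\<lambda>h. \<eta> x *\<^sub>R ?D x h + E x h *\<^sub>R \<phi> x)) (at x)" for x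
    by (rule has_derivative_scaleR[OF der C1c_fields_has_derivative[OF \<phi>]])
  note fd = frechet_derivative_at[OF d, symmetric]
  have c\<eta>: "continuous_on UNIV \<eta>"
    using der by (intro has_derivative_continuous_on) (auto intro: has_derivative_at_withinI)
  have c\<phi>: "continuous_on UNIV \<phi>"
    using C1c_fields_has_derivative[OF \<phi>]
    by (intro has_derivative_continuous_on) (auto intro: has_derivative_at_withinI)
  have sub: "closure {x. \<eta> x *\<^sub>R \<phi> x \<noteq> 0} \<subseteq> closure {x. \<phi> x \<noteq> 0}"
    by (rule closure_mono) auto
  show "(\<lambda>x. \<eta> x *\<^sub>R \<phi> x) \<in> C1c_fields \<Omega>"
    unfolding C1c_fields_def
  proof (intro CollectI conjI allI)
    show "(\<lambda>x. \<eta> x *\<^sub>R \<phi> x) differentiable at x" for x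
      using d by (rule differentiableI)
    show "continuous_on UNIV (\<lambda>x. frechet_derivative (\<lambda>x. \<eta> x *\<^sub>R \<phi> x) (at x) h)" for h
      unfolding fd using \<phi> by (intro continuous_intros c\<eta> c\<phi> cont) (auto simp: C1c_fields_def)
    show "compact (closure {x. \<eta> x *\<^sub>R \<phi> x \<noteq> 0})"
      using compact_Int_closed[OF C1c_fields_support(1)[OF \<phi>] closed_closure[of "{x. \<eta> x *\<^sub>R \<phi> x \<noteq> 0}"]]
      by (simp only: Int_absorb1[OF sub])
    show "closure {x. \<eta> x *\<^sub>R \<phi> x \<noteq> 0} \<subseteq> \<Omega>"
      using sub C1c_fields_support(2)[OF \<phi>] by blast
  qed
  have "E x (\<phi> x) = E x (\<Sum>b\<in>Basis. (\<phi> x \<bullet> b) *\<^sub>R b)" by (simp add: euclidean_representation)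
  also have "\<dots> = (\<Sum>b\<in>Basis. (\<phi> x \<bullet> b) * E x b)"
    using has_derivative_linear[OF der] by (simp add: linear_sum linear_scale)
  finally show "divergence (\<lambda>x. \<eta> x *\<^sub>R \<phi> x) x = \<eta> x * divergence \<phi> x + E x (\<phi> x)"
    unfolding divergence_eq[OF d]
    by (simp add: divergence_def inner_add_left sum.distrib sum_distrib_left mult.commute)
qed

section \<open>Cutoff functions on thin annuli\<close>

lemma hinge_square_derivative:
  "((\<lambda>t::real. (max 0 t)\<^sup>2) has_real_derivative 2 * max 0 t) (at t)"
proof -
  consider "t < 0" | "t = 0" | "0 < t" by linarith
  then show ?thesis
  proof cases
    case 1
    have "((\<lambda>t::real. 0) has_real_derivative 0) (at t)" by simp
    then have "((\<lambda>t::real. (max 0 t)\<^sup>2) has_real_derivative 0) (at t)"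
      by (rule has_field_derivative_transform_within_open[where S = "{..<0}"]) (use 1 in auto)
    with 1 show ?thesis by simp
  next
    case 2
    have "((\<lambda>h::real. (max 0 h)\<^sup>2 / h) \<longlongrightarrow> 0) (at 0)"
    proof (rule Lim_null_comparison)
      show "\<forall>\<^sub>F h in at 0. norm ((max 0 h)\<^sup>2 / h) \<le> \<bar>h\<bar>"
        by (intro always_eventually allI) (auto simp: max_def power2_eq_square)
      show "((\<lambda>h::real. \<bar>h\<bar>) \<longlongrightarrow> 0) (at 0)"
        by (auto intro!: tendsto_eq_intros)
    qed
    with 2 show ?thesis by (simp add: has_field_derivative_iff)
  next
    case 3
    have "((\<lambda>t::real. t\<^sup>2) has_real_derivative 2 * t) (at t)"
      by (auto intro!: derivative_eq_intros)
    then have "((\<lambda>t::real. (max 0 t)\<^sup>2) has_real_derivative 2 * t) (at t)"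
      by (rule has_field_derivative_transform_within_open[where S = "{0<..}"]) (use 3 in auto)
    with 3 show ?thesis by simp
  qed
qed

text \<open>
  The quadratic spline with nodes \<open>0\<close>, \<open>1/2\<close> and \<open>1\<close>, written with truncated squares; its derivative
  is the hat function of height \<open>2\<close>.
\<close>

lemma C1_unit_step:
  obtains \<psi> \<psi>' :: "real \<Rightarrow> real" where
    "\<And>t. (\<psi> has_real_derivative \<psi>' t) (at t)" "continuous_on UNIV \<psi>'"
    "\<And>t. t \<le> 0 \<Longrightarrow> \<psi> t = 0" "\<And>t. 1 \<le> t \<Longrightarrow> \<psi> t = 1" "\<And>t. 0 \<le> \<psi> t \<and> \<psi> t \<le> 1"
    "\<And>t. \<bar>\<psi>' t\<bar> \<le> 2" "\<And>t. t < 0 \<or> 1 < t \<Longrightarrow> \<psi>' t = 0"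
proof
  let ?q = "\<lambda>t::real. (max 0 t)\<^sup>2"
  let ?\<psi> = "\<lambda>t::real. 2 * ?q t - 4 * ?q (t - 1/2) + 2 * ?q (t - 1)"
  let ?\<psi>' = "\<lambda>t::real. 4 * max 0 t - 8 * max 0 (t - 1/2) + 4 * max 0 (t - 1)"
  show "(?\<psi> has_real_derivative ?\<psi>' t) (at t)" for t
  proof -
    have s: "((\<lambda>t. ?q (t - a)) has_real_derivative 2 * max 0 (t - a)) (at t)" for a
      by (rule DERIV_chain'[where f = "\<lambda>t. t - a" and g = ?q and D = 1, simplified])
        (auto intro!: derivative_eq_intros hinge_square_derivative)
    have s0: "(?q has_real_derivative 2 * max 0 t) (at t)" by (rule hinge_square_derivative)
    from DERIV_add[OF DERIV_diff[OF DERIV_cmult[OF s0, of 2] DERIV_cmult[OF s[of "1/2"], of 4]]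
        DERIV_cmult[OF s[of 1], of 2]]
    show ?thesis by simp
  qed
  show "continuous_on UNIV ?\<psi>'" by (intro continuous_intros)
  show "?\<psi> t = 0" if "t \<le> 0" for t using that by simp
  show one: "?\<psi> t = 1" if "1 \<le> t" for t
    using that by (simp add: max_def power2_eq_square field_simps)
  show "0 \<le> ?\<psi> t \<and> ?\<psi> t \<le> 1" for t
  proof -
    consider "t \<le> 0" | "0 < t" "t \<le> 1/2" | "1/2 < t" "t < 1" | "1 \<le> t" by linarith
    then show ?thesis
    proof cases
      case 2
      have "?\<psi> t = 2 * t\<^sup>2" using 2 by (simp add: max_absorb1 max_absorb2)
      moreover have "t\<^sup>2 \<le> (1/2)\<^sup>2" using 2 by (intro power_mono) auto
      ultimately show ?thesis by (simp add: power_divide)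
    next
      case 3
      have eq: "?\<psi> t = 1 - 2 * (1 - t)\<^sup>2"
        using 3 by (simp add: max_def power2_eq_square field_simps)
      have "(1 - t)\<^sup>2 \<le> (1/2)\<^sup>2" using 3 by (intro power_mono) auto
      then have "2 * (1 - t)\<^sup>2 \<le> 1" by (simp add: power_divide)
      then show ?thesis unfolding eq by simp
    next
      case 4
      then show ?thesis using one[of t] by simp
    qed simp
  qed
  show "\<bar>?\<psi>' t\<bar> \<le> 2" for t by (simp add: max_def)
  show "?\<psi>' t = 0" if "t < 0 \<or> 1 < t" for t using that by auto
qed

text \<open>
  The unit step is composed with the squared distance from \<open>c\<close>, rescaled affinely so that the radii
  \<open>r\<close> and \<open>r + \<epsilon>\<close> correspond to \<open>0\<close> and \<open>1\<close>.  The squared distance, unlike the distance, is smooth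
  at the centre.
\<close>

lemma annular_cutoff:
  fixes c :: "'a::euclidean_space"
  assumes \<epsilon>: "0 < \<epsilon>" "\<epsilon> \<le> r"
  obtains \<eta> E where
    "\<And>x. (\<eta> has_derivative E x) (at x)" "\<And>h. continuous_on UNIV (\<lambda>x. E x h)"
    "\<And>x. x \<in> cball c r \<Longrightarrow> \<eta> x = (0::real)" "\<And>x. x \<notin> cball c (r + \<epsilon>) \<Longrightarrow> \<eta> x = 1"
    "\<And>x. 0 \<le> \<eta> x \<and> \<eta> x \<le> 1"
    "\<And>x h. \<bar>E x h\<bar> \<le> 4 / \<epsilon> * norm h * indicator (cball c (r + \<epsilon>) - ball c r) x"
proof -
  obtain \<psi> \<psi>' :: "real \<Rightarrow> real" where \<psi>:
    "\<And>t. (\<psi> has_real_derivative \<psi>' t) (at t)" "continuous_on UNIV \<psi>'"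
    "\<And>t. t \<le> 0 \<Longrightarrow> \<psi> t = 0" "\<And>t. 1 \<le> t \<Longrightarrow> \<psi> t = 1" "\<And>t. 0 \<le> \<psi> t \<and> \<psi> t \<le> 1"
    "\<And>t. \<bar>\<psi>' t\<bar> \<le> 2" "\<And>t. t < 0 \<or> 1 < t \<Longrightarrow> \<psi>' t = 0"
    using C1_unit_step by blast
  have r: "0 < r" using \<epsilon> by simp
  define \<delta> where "\<delta> = (r + \<epsilon>)\<^sup>2 - r\<^sup>2"
  have \<delta>: "2 * r * \<epsilon> \<le> \<delta>" by (simp add: \<delta>_def power2_eq_square algebra_simps)
  have re: "0 < r * \<epsilon>" using r \<epsilon> by simp
  have \<delta>0: "0 < \<delta>" using \<delta> re by linarith
  define s where "s = (\<lambda>x. ((x - c) \<bullet> (x - c) - r\<^sup>2) / \<delta>)"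
  define E where "E = (\<lambda>x h. \<psi>' (s x) * (2 * ((x - c) \<bullet> h) / \<delta>))"
  have s_dist: "s x = ((dist c x)\<^sup>2 - r\<^sup>2) / \<delta>" for x
    by (simp add: s_def dist_norm norm_minus_commute dot_square_norm)
  have s_le0: "s x \<le> 0" if "dist c x \<le> r" for x
    using power_mono[OF that, of 2] \<delta>0 by (simp add: s_dist divide_le_0_iff)
  have s_lt0: "s x < 0" if "dist c x < r" for x
    using power_strict_mono[OF that, of 2] \<delta>0 by (simp add: s_dist divide_neg_pos)
  have s_gt1: "1 < s x" if "r + \<epsilon> < dist c x" for x
    using power_strict_mono[OF that, of 2] \<delta>0 r \<epsilon> by (simp add: s_dist \<delta>_def)
  show ?thesis
  proof (rule that[of "\<lambda>x. \<psi> (s x)" E])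
    fix x
    have "(s has_derivative (\<lambda>h. 2 * ((x - c) \<bullet> h) / \<delta>)) (at x)"
      unfolding s_def using \<delta>0
      by (auto intro!: derivative_eq_intros simp: inner_commute fun_eq_iff field_simps)
    moreover have "(\<psi> has_derivative (\<lambda>u. \<psi>' (s x) * u)) (at (s x))"
      using \<psi>(1) by (simp add: has_field_derivative_def)
    ultimately show "((\<lambda>x. \<psi> (s x)) has_derivative E x) (at x)"
      unfolding E_def by (rule has_derivative_compose)
    show "\<psi> (s x) = 0" if "x \<in> cball c r"
      using that by (intro \<psi> s_le0) auto
    show "\<psi> (s x) = 1" if "x \<notin> cball c (r + \<epsilon>)"
      using that s_gt1[of x] by (intro \<psi>) auto
    show "0 \<le> \<psi> (s x) \<and> \<psi> (s x) \<le> 1" by (rule \<psi>)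
  next
    fix h
    have "continuous_on UNIV s" unfolding s_def by (intro continuous_intros) (use \<delta>0 in auto)
    then have "continuous_on UNIV (\<lambda>x. \<psi>' (s x))"
      by (rule continuous_on_compose2[OF \<psi>(2)]) auto
    then show "continuous_on UNIV (\<lambda>x. E x h)"
      unfolding E_def using \<delta>0 by (intro continuous_intros) auto
  next
    fix x h
    show "\<bar>E x h\<bar> \<le> 4 / \<epsilon> * norm h * indicator (cball c (r + \<epsilon>) - ball c r) x"
    proof (cases "x \<in> cball c (r + \<epsilon>) - ball c r")
      case False
      then have "s x < 0 \<or> 1 < s x" using s_lt0[of x] s_gt1[of x] by auto
      then show ?thesis using False \<psi>(7) by (simp add: E_def)
    next
      case True
      then have d: "norm (x - c) \<le> 2 * r" using \<epsilon> by (auto simp: dist_norm norm_minus_commute)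
      have "\<bar>(x - c) \<bullet> h\<bar> \<le> norm (x - c) * norm h" by (rule Cauchy_Schwarz_ineq2)
      also have "\<dots> \<le> 2 * r * norm h" using d by (intro mult_right_mono) auto
      finally have 1: "2 * \<bar>(x - c) \<bullet> h\<bar> / \<delta> \<le> (4 * r * norm h) / (2 * r * \<epsilon>)"
        using \<delta> re r \<epsilon> by (intro frac_le) (auto simp: mult_ac)
      have "\<bar>E x h\<bar> = \<bar>\<psi>' (s x)\<bar> * (2 * \<bar>(x - c) \<bullet> h\<bar> / \<delta>)"
        using \<delta>0 by (simp add: E_def abs_mult)
      also have "\<dots> \<le> 2 * ((4 * r * norm h) / (2 * r * \<epsilon>))"
        using \<psi>(6) 1 \<delta>0 by (intro mult_mono) auto
      also have "\<dots> = 4 / \<epsilon> * norm h" using r \<epsilon> by (simp add: field_simps)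
      finally show ?thesis using True by simp
    qed
  qed
qed

lemma power_diff_le:
  fixes a b :: real
  assumes "0 \<le> a" "a \<le> b"
  shows "b ^ n - a ^ n \<le> real n * (b - a) * b ^ (n - 1)"
proof -
  have "b ^ n - a ^ n = (b - a) * (\<Sum>i<n. a ^ (n - Suc i) * b ^ i)"
    by (rule power_diff_sumr2)
  also have "\<dots> \<le> (b - a) * (\<Sum>i<n. b ^ (n - 1))"
  proof (intro mult_left_mono sum_mono)
    fix i assume i: "i \<in> {..<n}"
    have "a ^ (n - Suc i) * b ^ i \<le> b ^ (n - Suc i) * b ^ i"
      using assms by (intro mult_right_mono power_mono) auto
    also have "\<dots> = b ^ (n - 1)" using i by (simp flip: power_add)
    finally show "a ^ (n - Suc i) * b ^ i \<le> b ^ (n - 1)" .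
  qed (use assms in auto)
  finally show ?thesis by (simp add: mult_ac)
qed

lemma measure_annulus_le:
  fixes c :: "'a::euclidean_space"
  assumes "0 \<le> \<epsilon>" "\<epsilon> \<le> r"
  shows "measure lebesgue (cball c (r + \<epsilon>) - ball c r)
    \<le> \<epsilon> * (unit_ball_vol DIM('a) * DIM('a) * (2 * r) ^ (DIM('a) - 1))"
proof -
  have r: "0 \<le> r" using assms by simp
  have "measure lebesgue (cball c (r + \<epsilon>) - ball c r) = measure lebesgue (cball c (r + \<epsilon>)) - measure lebesgue (ball c r)"
    using assms by (intro measurable_measure_Diff) auto
  also have "\<dots> = unit_ball_vol DIM('a) * ((r + \<epsilon>) ^ DIM('a) - r ^ DIM('a))"
    using content_cball[of "r + \<epsilon>" c] content_ball[of r c] assms by (simp add: right_diff_distrib)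
  also have "\<dots> \<le> unit_ball_vol DIM('a) * (DIM('a) * \<epsilon> * (2 * r) ^ (DIM('a) - 1))"
  proof (rule mult_left_mono)
    have "(r + \<epsilon>) ^ DIM('a) - r ^ DIM('a) \<le> DIM('a) * \<epsilon> * (r + \<epsilon>) ^ (DIM('a) - 1)"
      using power_diff_le[of r "r + \<epsilon>" "DIM('a)"] assms by simp
    also have "\<dots> \<le> DIM('a) * \<epsilon> * (2 * r) ^ (DIM('a) - 1)"
      using assms by (intro mult_left_mono power_mono) auto
    finally show "(r + \<epsilon>) ^ DIM('a) - r ^ DIM('a) \<le> DIM('a) * \<epsilon> * (2 * r) ^ (DIM('a) - 1)" .
  qed simp
  finally show ?thesis by (simp add: mult_ac)
qed

section \<open>Semicontinuity and shift invariance of the total variation\<close>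

lemma TV_upper:
  assumes "\<phi> \<in> C1c_fields \<Omega>" "\<And>x. norm (\<phi> x) \<le> 1"
  shows "ereal (LINT x|lebesgue_on \<Omega>. u x * divergence \<phi> x) \<le> TV \<Omega> u"
  unfolding TV_def using assms by (intro SUP_upper) auto

lemma TV_least:
  assumes "\<And>\<phi>. \<phi> \<in> C1c_fields \<Omega> \<Longrightarrow> (\<And>x. norm (\<phi> x) \<le> 1) \<Longrightarrow>
    ereal (LINT x|lebesgue_on \<Omega>. u x * divergence \<phi> x) \<le> B"
  shows "TV \<Omega> u \<le> B"
  unfolding TV_def using assms by (intro SUP_least) auto

lemma integrable_const_lebesgue_on:
  assumes "\<Omega> \<in> lmeasurable"
  shows "integrable (lebesgue_on \<Omega>) (\<lambda>_. k :: real)"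
  using assms by (simp add: finite_measure.integrable_const finite_measure_lebesgue_on)

text \<open>
  Constants do not see the test fields, since these have divergence of mean zero.
\<close>

lemma TV_add_const:
  assumes \<Omega>: "\<Omega> \<in> lmeasurable" and u: "integrable (lebesgue_on \<Omega>) u"
  shows "TV \<Omega> (\<lambda>x. u x + b) = TV \<Omega> u"
proof -
  have "(LINT x|lebesgue_on \<Omega>. (u x + b) * divergence \<phi> x) = (LINT x|lebesgue_on \<Omega>. u x * divergence \<phi> x)"
    if \<phi>: "\<phi> \<in> C1c_fields \<Omega>" for \<phi>
  proof -
    have "(LINT x|lebesgue_on \<Omega>. (u x + b) * divergence \<phi> x)
        = (LINT x|lebesgue_on \<Omega>. u x * divergence \<phi> x) + (LINT x|lebesgue_on \<Omega>. b * divergence \<phi> x)"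
      unfolding distrib_right
      by (intro Bochner_Integration.integral_add integrable_mult_divergence[OF _ \<phi>] u
          integrable_const_lebesgue_on[OF \<Omega>])
    also have "(LINT x|lebesgue_on \<Omega>. b * divergence \<phi> x) = 0"
      using integral_divergence_eq_0[OF fmeasurableD[OF \<Omega>] \<phi>] by simp
    finally show ?thesis by simp
  qed
  then show ?thesis
    unfolding TV_def by (intro SUP_cong) auto
qed

text \<open>
  The total variation is a supremum of functionals that are continuous in \<open>L\<^sup>1\<close>, because the
  divergence of a test field is bounded.
\<close>

lemma TV_lower_semicontinuous:
  assumes un: "\<And>n. integrable (lebesgue_on \<Omega>) (u\<^sub>n n)" and u: "integrable (lebesgue_on \<Omega>) u"
    and lim: "(\<lambda>n. L1_norm \<Omega> (\<lambda>x. u\<^sub>n n x - u x)) \<longlonglongrightarrow> 0"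
  shows "TV \<Omega> u \<le> liminf (\<lambda>n. TV \<Omega> (u\<^sub>n n))"
proof (rule TV_least)
  fix \<phi> :: "'a \<Rightarrow> 'a"
  assume \<phi>: "\<phi> \<in> C1c_fields \<Omega>" "\<And>x. norm (\<phi> x) \<le> 1"
  let ?I = "\<lambda>u. LINT x|lebesgue_on \<Omega>. u x * divergence \<phi> x"
  obtain M where M: "0 < M" "\<And>x. \<bar>divergence \<phi> x\<bar> \<le> M"
    using divergence_bounded[OF \<phi>(1)] by blast
  have "norm (?I (u\<^sub>n n) - ?I u) \<le> L1_norm \<Omega> (\<lambda>x. u\<^sub>n n x - u x) * M" for n
  proof -
    have "?I (u\<^sub>n n) - ?I u = (LINT x|lebesgue_on \<Omega>. (u\<^sub>n n x - u x) * divergence \<phi> x)"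
      unfolding left_diff_distrib
      by (rule Bochner_Integration.integral_diff[symmetric])
        (intro integrable_mult_divergence[OF _ \<phi>(1)] un u)+
    also have "norm \<dots> \<le> (LINT x|lebesgue_on \<Omega>. norm ((u\<^sub>n n x - u x) * divergence \<phi> x))"
      by (rule integral_norm_bound)
    also have "\<dots> \<le> (LINT x|lebesgue_on \<Omega>. \<bar>u\<^sub>n n x - u x\<bar> * M)"
    proof (rule integral_mono)
      show "integrable (lebesgue_on \<Omega>) (\<lambda>x. norm ((u\<^sub>n n x - u x) * divergence \<phi> x))"
        using un u by (intro integrable_norm integrable_mult_divergence[OF _ \<phi>(1)]) auto
      show "norm ((u\<^sub>n n x - u x) * divergence \<phi> x) \<le> \<bar>u\<^sub>n n x - u x\<bar> * M" for x
        using M by (simp add: abs_mult mult_left_mono)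
    qed (use un u in auto)
    also have "\<dots> = L1_norm \<Omega> (\<lambda>x. u\<^sub>n n x - u x) * M"
      by (simp add: L1_norm_def)
    finally show ?thesis .
  qed
  moreover have "(\<lambda>n. L1_norm \<Omega> (\<lambda>x. u\<^sub>n n x - u x) * M) \<longlonglongrightarrow> 0"
    by (rule tendsto_mult_left_zero[OF lim])
  ultimately have "(\<lambda>n. ?I (u\<^sub>n n) - ?I u) \<longlonglongrightarrow> 0"
    by (intro Lim_null_comparison[of "\<lambda>n. ?I (u\<^sub>n n) - ?I u"] always_eventually allI)
  then have "(\<lambda>n. ?I (u\<^sub>n n)) \<longlonglongrightarrow> ?I u"
    by (rule LIM_zero_cancel)
  then have "ereal (?I u) = liminf (\<lambda>n. ereal (?I (u\<^sub>n n)))"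
    by (intro lim_imp_Liminf[symmetric]) auto
  also have "\<dots> \<le> liminf (\<lambda>n. TV \<Omega> (u\<^sub>n n))"
    by (intro Liminf_mono always_eventually allI TV_upper \<phi>)
  finally show "ereal (?I u) \<le> liminf (\<lambda>n. TV \<Omega> (u\<^sub>n n))" .
qed

section \<open>Setting a function to zero on a ball\<close>

lemma integral_indicator_lebesgue_on:
  assumes "\<Omega> \<in> sets lebesgue" "A \<in> lmeasurable"
  shows "integrable (lebesgue_on \<Omega>) (indicator A :: 'a::euclidean_space \<Rightarrow> real)"
    and "(LINT x|lebesgue_on \<Omega>. indicator A x :: real) = measure lebesgue (A \<inter> \<Omega>)"
    and "(LINT x|lebesgue_on \<Omega>. indicator A x :: real) \<le> measure lebesgue A"
proof -
  have "A \<inter> \<Omega> \<in> sets lebesgue" "emeasure lebesgue (A \<inter> \<Omega>) < \<infinity>"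
    using fmeasurable_Int_fmeasurable[OF assms(2,1)] by (auto simp: fmeasurable_def)
  then have 1: "integrable lebesgue (indicator (A \<inter> \<Omega>) :: 'a \<Rightarrow> real)"
    by (rule integrable_real_indicator)
  have eq: "(\<lambda>x. indicator \<Omega> x * (indicator A x :: real)) = indicator (A \<inter> \<Omega>)"
    by (auto simp: indicator_def)
  show "integrable (lebesgue_on \<Omega>) (indicator A :: 'a \<Rightarrow> real)"
    using assms 1 by (simp add: integrable_restrict_space eq)
  show "(LINT x|lebesgue_on \<Omega>. indicator A x :: real) = measure lebesgue (A \<inter> \<Omega>)"
    using assms by (simp add: measure_restrict_space)
  then show "(LINT x|lebesgue_on \<Omega>. indicator A x :: real) \<le> measure lebesgue A"
    using assms by (auto intro!: measure_mono_fmeasurable)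
qed

text \<open>
  The truncated function is the limit of \<open>u \<eta>\<close> for cutoffs \<open>\<eta>\<close> on annuli of width \<open>\<epsilon> \<rightarrow> 0\<close> around
  the ball.  By the product rule \<open>\<integral> u \<eta> div \<phi>\<close> differs from \<open>\<integral> u div (\<eta> \<phi>) \<le> TV u\<close> by at most
  \<open>K\<close> times the integral of \<open>\<bar>\<nabla>\<eta>\<bar> \<le> 4 / \<epsilon>\<close> over the annulus, and the volume of the annulus is
  \<open>O(\<epsilon> r\<^bsup>d - 1\<^esup>)\<close>.
\<close>

lemma TV_set_zero_on_ball:
  fixes c :: "'a::euclidean_space"
  assumes \<Omega>: "\<Omega> \<in> lmeasurable" and u: "integrable (lebesgue_on \<Omega>) u"
    and K: "AE x in lebesgue_on \<Omega>. \<bar>u x\<bar> \<le> K" "0 \<le> K" and r: "0 < r"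
  shows "TV \<Omega> (\<lambda>x. if x \<in> cball c r then 0 else u x)
    \<le> TV \<Omega> u + ereal (K * (4 * (unit_ball_vol DIM('a) * DIM('a) * (2 * r) ^ (DIM('a) - 1))))"
proof (cases "TV \<Omega> u = \<infinity>")
  case False
  define S where "S = 4 * (unit_ball_vol DIM('a) * DIM('a) * (2 * r) ^ (DIM('a) - 1))"
  obtain T where T: "TV \<Omega> u = ereal T"
    using False TV_nonneg[of \<Omega> u] by (cases "TV \<Omega> u") auto
  have \<Omega>s: "\<Omega> \<in> sets lebesgue" using \<Omega> by (rule fmeasurableD)
  let ?M = "lebesgue_on \<Omega>"
  have "TV \<Omega> (\<lambda>x. if x \<in> cball c r then 0 else u x) \<le> ereal (T + K * S)"
  proof (rule TV_least)
    fix \<phi> :: "'a \<Rightarrow> 'a"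
    assume \<phi>: "\<phi> \<in> C1c_fields \<Omega>" "\<And>x. norm (\<phi> x) \<le> 1"
    have u_meas: "u \<in> borel_measurable ?M" using u by simp
    have cut: "\<exists>\<eta>. \<eta> \<in> borel_measurable ?M \<and> (\<forall>x\<in>cball c r. \<eta> x = 0) \<and> (\<forall>x. x \<notin> cball c (r + \<epsilon>) \<longrightarrow> \<eta> x = 1)
       \<and> (\<forall>x. 0 \<le> \<eta> x \<and> \<eta> x \<le> 1) \<and> (LINT x|?M. u x * \<eta> x * divergence \<phi> x) \<le> T + K * S"
      if \<epsilon>: "0 < \<epsilon>" "\<epsilon> \<le> r" for \<epsilon>
    proof -
      let ?A = "cball c (r + \<epsilon>) - ball c r"
      obtain \<eta> E where \<eta>: "\<And>x. (\<eta> has_derivative E x) (at x)" "\<And>h. continuous_on UNIV (\<lambda>x. E x h)"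
        "\<And>x. x \<in> cball c r \<Longrightarrow> \<eta> x = (0::real)" "\<And>x. x \<notin> cball c (r + \<epsilon>) \<Longrightarrow> \<eta> x = 1"
        "\<And>x. 0 \<le> \<eta> x \<and> \<eta> x \<le> 1"
        "\<And>x h. \<bar>E x h\<bar> \<le> 4 / \<epsilon> * norm h * indicator ?A x"
        using annular_cutoff[OF \<epsilon>, of c] by blast
      have "continuous_on UNIV \<eta>"
        using \<eta>(1) by (intro has_derivative_continuous_on) (auto intro: has_derivative_at_withinI)
      then have \<eta>m: "\<eta> \<in> borel_measurable ?M"
        using \<Omega>s by (meson continuous_imp_measurable_on_sets_lebesgue continuous_on_subset subset_UNIV)
      note cf = cutoff_field[OF \<phi>(1) \<eta>(1,2)]
      let ?\<chi> = "\<lambda>x. \<eta> x *\<^sub>R \<phi> x"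
      have \<chi>1: "norm (?\<chi> x) \<le> 1" for x
        using \<eta>(5)[of x] \<phi>(2)[of x] mult_mono[of "\<eta> x" 1 "norm (\<phi> x)" 1] by simp
      have i1: "integrable ?M (\<lambda>x. u x * divergence ?\<chi> x)"
        by (rule integrable_mult_divergence[OF u cf(1)])
      have "integrable ?M (\<lambda>x. u x * \<eta> x)"
      proof (rule Bochner_Integration.integrable_bound[OF u])
        show "(\<lambda>x. u x * \<eta> x) \<in> borel_measurable ?M"
          using u_meas \<eta>m by (rule borel_measurable_times)
        show "AE x in ?M. norm (u x * \<eta> x) \<le> norm (u x)"
          using \<eta>(5) by (intro AE_I2) (simp add: abs_mult mult_left_le)
      qed
      from integrable_mult_divergence[OF this \<phi>(1)]
      have i2: "integrable ?M (\<lambda>x. u x * \<eta> x * divergence \<phi> x)" .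
      have e: "u x * divergence ?\<chi> x - u x * \<eta> x * divergence \<phi> x = u x * E x (\<phi> x)" for x
        by (simp add: cf(2) algebra_simps)
      have i3: "integrable ?M (\<lambda>x. u x * E x (\<phi> x))"
        using Bochner_Integration.integrable_diff[OF i1 i2] by (simp add: e)
      have eq: "(LINT x|?M. u x * divergence ?\<chi> x) - (LINT x|?M. u x * \<eta> x * divergence \<phi> x)
          = (LINT x|?M. u x * E x (\<phi> x))"
        using Bochner_Integration.integral_diff[OF i1 i2] by (simp add: e)
      have le1: "(LINT x|?M. u x * divergence ?\<chi> x) \<le> T"
        using TV_upper[OF cf(1) \<chi>1, of u] T by simp
      have A: "?A \<in> lmeasurable" by (intro fmeasurable.Diff) auto
      have "\<bar>LINT x|?M. u x * E x (\<phi> x)\<bar> \<le> (LINT x|?M. \<bar>u x * E x (\<phi> x)\<bar>)"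
        by (rule integral_abs_bound)
      also have "\<dots> \<le> (LINT x|?M. K * (4 / \<epsilon>) * indicator ?A x)"
      proof (rule integral_mono_AE)
        show "integrable ?M (\<lambda>x. \<bar>u x * E x (\<phi> x)\<bar>)" using i3 by simp
        show "integrable ?M (\<lambda>x. K * (4 / \<epsilon>) * indicator ?A x)"
          using integral_indicator_lebesgue_on(1)[OF \<Omega>s A] by (rule integrable_mult_right)
        show "AE x in ?M. \<bar>u x * E x (\<phi> x)\<bar> \<le> K * (4 / \<epsilon>) * indicator ?A x"
          using K(1)
        proof eventually_elim
          case (elim x)
          have "\<bar>E x (\<phi> x)\<bar> \<le> 4 / \<epsilon> * norm (\<phi> x) * indicator ?A x" by (rule \<eta>(6))
          also have "\<dots> \<le> 4 / \<epsilon> * 1 * indicator ?A x"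
            using \<phi>(2) \<epsilon> by (intro mult_right_mono mult_left_mono) auto
          finally have "\<bar>u x\<bar> * \<bar>E x (\<phi> x)\<bar> \<le> K * (4 / \<epsilon> * 1 * indicator ?A x)"
            using elim K(2) by (intro mult_mono) auto
          then show ?case by (simp add: abs_mult mult.assoc)
        qed
      qed
      also have "\<dots> = K * (4 / \<epsilon>) * (LINT x|?M. indicator ?A x)" by simp
      also have "\<dots> \<le> K * (4 / \<epsilon>) * measure lebesgue ?A"
        using K(2) \<epsilon> by (intro mult_left_mono integral_indicator_lebesgue_on(3)[OF \<Omega>s A]) auto
      also have "\<dots> \<le> K * (4 / \<epsilon>) * (\<epsilon> * (unit_ball_vol DIM('a) * DIM('a) * (2 * r) ^ (DIM('a) - 1)))"
        using K(2) \<epsilon> by (intro mult_left_mono measure_annulus_le) auto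
      also have "\<dots> = K * S" using \<epsilon> by (simp add: S_def)
      finally have "(LINT x|?M. u x * \<eta> x * divergence \<phi> x) \<le> T + K * S"
        using eq le1 by linarith
      with \<eta>(3-5) \<eta>m show ?thesis by blast
    qed
    have "\<exists>\<eta>. \<eta> \<in> borel_measurable ?M \<and> (\<forall>x\<in>cball c r. \<eta> x = 0)
         \<and> (\<forall>x. x \<notin> cball c (r + r / real (Suc n)) \<longrightarrow> \<eta> x = 1)
         \<and> (\<forall>x. 0 \<le> \<eta> x \<and> \<eta> x \<le> 1) \<and> (LINT x|?M. u x * \<eta> x * divergence \<phi> x) \<le> T + K * S" for n
    proof (rule cut)
      have "r / real (Suc n) \<le> r / 1" using r by (intro divide_left_mono) auto
      then show "r / real (Suc n) \<le> r" by simp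
    qed (use r in simp)
    from choice[OF allI[OF this]] obtain \<eta> where all:
      "\<forall>n. \<eta> n \<in> borel_measurable ?M \<and> (\<forall>x\<in>cball c r. \<eta> n x = 0)
         \<and> (\<forall>x. x \<notin> cball c (r + r / real (Suc n)) \<longrightarrow> \<eta> n x = 1)
         \<and> (\<forall>x. 0 \<le> \<eta> n x \<and> \<eta> n x \<le> 1) \<and> (LINT x|?M. u x * \<eta> n x * divergence \<phi> x) \<le> T + K * S" ..
    have \<eta>: "\<And>n. \<eta> n \<in> borel_measurable ?M" "\<And>n x. x \<in> cball c r \<Longrightarrow> \<eta> n x = 0"
       "\<And>n x. x \<notin> cball c (r + r / real (Suc n)) \<Longrightarrow> \<eta> n x = 1"
       "\<And>n x. 0 \<le> \<eta> n x \<and> \<eta> n x \<le> 1"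
       "\<And>n. (LINT x|?M. u x * \<eta> n x * divergence \<phi> x) \<le> T + K * S"
      using all by blast+
    let ?w = "\<lambda>x. if x \<in> cball c r then 0 else u x"
    have \<eta>lim: "(\<lambda>n. u x * \<eta> n x) \<longlonglongrightarrow> ?w x" for x
    proof (cases "x \<in> cball c r")
      case True then show ?thesis using \<eta>(2) by simp
    next
      case False
      then have "0 < dist c x - r" by simp
      moreover have "(\<lambda>n. r / real (Suc n)) \<longlonglongrightarrow> 0"
        using tendsto_mult_right_zero[OF LIMSEQ_inverse_real_of_nat, of r] by (simp add: divide_inverse)
      ultimately have "\<forall>\<^sub>F n in sequentially. r / real (Suc n) < dist c x - r"
        using order_tendstoD(2) by blast
      then have "\<forall>\<^sub>F n in sequentially. u x * \<eta> n x = u x"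
        by eventually_elim (use \<eta>(3) in auto)
      then show ?thesis using False by (simp add: tendsto_eventually)
    qed
    have "(\<lambda>n. LINT x|?M. u x * \<eta> n x * divergence \<phi> x) \<longlonglongrightarrow> (LINT x|?M. ?w x * divergence \<phi> x)"
    proof (rule integral_dominated_convergence[where w = "\<lambda>x. \<bar>u x * divergence \<phi> x\<bar>"])
      have m\<phi>: "divergence \<phi> \<in> borel_measurable ?M" by (rule borel_measurable_divergence[OF \<phi>(1)])
      show mn: "(\<lambda>x. u x * \<eta> n x * divergence \<phi> x) \<in> borel_measurable ?M" for n
        by (intro borel_measurable_times u_meas \<eta>(1) m\<phi>)
      have lim: "(\<lambda>n. u x * \<eta> n x * divergence \<phi> x) \<longlonglongrightarrow> ?w x * divergence \<phi> x" for x
        by (intro tendsto_mult \<eta>lim tendsto_const)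
      show "(\<lambda>x. ?w x * divergence \<phi> x) \<in> borel_measurable ?M"
        by (rule borel_measurable_LIMSEQ_real[OF lim mn])
      show "AE x in ?M. (\<lambda>n. u x * \<eta> n x * divergence \<phi> x) \<longlonglongrightarrow> ?w x * divergence \<phi> x"
        using lim by (rule AE_I2)
      show "integrable ?M (\<lambda>x. \<bar>u x * divergence \<phi> x\<bar>)"
        using integrable_mult_divergence[OF u \<phi>(1)] by simp
      show "AE x in ?M. norm (u x * \<eta> n x * divergence \<phi> x) \<le> \<bar>u x * divergence \<phi> x\<bar>" for n
      proof (rule AE_I2)
        fix x
        have "\<bar>u x * divergence \<phi> x\<bar> * \<bar>\<eta> n x\<bar> \<le> \<bar>u x * divergence \<phi> x\<bar>"
          using \<eta>(4)[of n x] by (intro mult_left_le) auto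
        then show "norm (u x * \<eta> n x * divergence \<phi> x) \<le> \<bar>u x * divergence \<phi> x\<bar>"
          by (simp add: abs_mult mult_ac)
      qed
    qed
    then have "(LINT x|?M. ?w x * divergence \<phi> x) \<le> T + K * S"
      by (rule LIMSEQ_le_const2) (use \<eta>(5) in blast)
    then show "ereal (LINT x|?M. ?w x * divergence \<phi> x) \<le> ereal (T + K * S)" by simp
  qed
  then show ?thesis by (simp add: T S_def)
qed simp

section \<open>Balls almost filled by a set of positive measure\<close>

text \<open>
  A weak form of the Lebesgue density theorem: the centre of the ball may depend on the radius.  If every small ball had more than the fraction \<open>\<theta>\<close> of its volume outside of \<open>E\<close>, then a
  Vitali covering by disjoint small balls of an open \<open>U \<supseteq> E\<close> would show that \<open>U - E\<close> has measure
  at least \<open>\<theta>\<close> times that of \<open>E\<close>, whereas \<open>U\<close> can be chosen to approximate \<open>E\<close> better than this.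
\<close>

lemma exists_small_ball_mostly_in:
  fixes E :: "'a::euclidean_space set"
  assumes E: "E \<in> lmeasurable" and pos: "0 < measure lebesgue E" and \<theta>: "0 < \<theta>" and \<rho>: "0 < \<rho>"
  obtains c r where "0 < r" "r < \<rho>" "measure lebesgue (cball c r - E) \<le> \<theta> * measure lebesgue (cball c r)"
proof (rule ccontr)
  note result = that
  assume no: "\<not> thesis"
  have bad: "\<theta> * measure lebesgue (cball c r) < measure lebesgue (cball c r - E)"
    if "0 < r" "r < \<rho>" for c r
    using no result[of r c] that by linarith
  have Es: "E \<in> sets lebesgue" using E by (rule fmeasurableD)
  obtain U where U: "open U" "E \<subseteq> U" "U - E \<in> lmeasurable"
    "emeasure lebesgue (U - E) < ennreal (\<theta> * measure lebesgue E)"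
    using sets_lebesgue_outer_open[OF Es, of "\<theta> * measure lebesgue E"] pos \<theta> by auto
  let ?K = "{p :: 'a \<times> real. 0 < snd p \<and> snd p < \<rho> \<and> ball (fst p) (snd p) \<subseteq> U}"
  have cover: "\<exists>i. i \<in> ?K \<and> x \<in> ball (fst i) (snd i) \<and> snd i < d" if x: "x \<in> U" and d: "0 < d" for x d
  proof -
    obtain e where e: "0 < e" "ball x e \<subseteq> U" using U(1) x openE by blast
    define s where "s = min (min e d) \<rho> / 2"
    have "0 < s" "s < e" "s < d" "s < \<rho>" using e d \<rho> by (auto simp: s_def min_def)
    then have "(x, s) \<in> ?K \<and> x \<in> ball x s \<and> s < d" using e(2) by auto
    then show ?thesis by (intro exI[of _ "(x, s)"]) auto
  qed
  obtain C where C: "countable C" "C \<subseteq> ?K"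
     "pairwise (\<lambda>i j. disjnt (ball (fst i) (snd i)) (ball (fst j) (snd j))) C"
     "negligible (U - (\<Union>i \<in> C. ball (fst i) (snd i)))"
    by (rule Vitali_covering_theorem_balls[where S = U and K = ?K and a = fst and r = snd, OF cover])
  let ?B = "\<lambda>i. ball (fst i) (snd i)"
  have disj1: "disjoint_family_on ?B C"
    using C(3) unfolding disjoint_family_on_def pairwise_def disjnt_def by blast
  then have disj2: "disjoint_family_on (\<lambda>i. ?B i - E) C"
    unfolding disjoint_family_on_def by blast
  have ball_le: "ennreal \<theta> * emeasure lebesgue (?B i) \<le> emeasure lebesgue (?B i - E)" if "i \<in> C" for i
  proof -
    have i: "0 < snd i" "snd i < \<rho>" using C(2) that by auto
    have D: "?B i - E \<in> lmeasurable" using Es by (intro fmeasurable_Diff) auto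
    have sph: "negligible (sphere (fst i) (snd i))" by (rule negligible_sphere)
    have "measure lebesgue (cball (fst i) (snd i) - E) = measure lebesgue (?B i - E)"
    proof (rule measure_negligible_symdiff)
      show "?B i - E \<in> lmeasurable" by (rule D)
      show "negligible ((?B i - E - (cball (fst i) (snd i) - E)) \<union> (cball (fst i) (snd i) - E - (?B i - E)))"
        by (rule negligible_subset[OF sph]) auto
    qed
    moreover have "measure lebesgue (cball (fst i) (snd i)) = measure lebesgue (?B i)"
      using content_cball[of "snd i" "fst i"] content_ball[of "snd i" "fst i"] i by simp
    ultimately have "\<theta> * measure lebesgue (?B i) \<le> measure lebesgue (?B i - E)"
      using bad[OF i, of "fst i"] by simp
    then have "ennreal (\<theta> * measure lebesgue (?B i)) \<le> ennreal (measure lebesgue (?B i - E))"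
      by (rule ennreal_leI)
    then show ?thesis
      using \<theta> D by (simp add: ennreal_mult emeasure_eq_measure2)
  qed
  have "ennreal \<theta> * emeasure lebesgue E \<le> ennreal \<theta> * emeasure lebesgue (\<Union>i\<in>C. ?B i)"
  proof (rule mult_left_mono)
    have meas: "(\<Union>i\<in>C. ?B i) \<in> sets lebesgue" using C(1) by (intro sets.countable_UN'') auto
    have "emeasure lebesgue E \<le> emeasure lebesgue (U - (\<Union>i\<in>C. ?B i) \<union> (\<Union>i\<in>C. ?B i))"
      using U(1,2) meas by (intro emeasure_mono) auto
    also have "\<dots> \<le> emeasure lebesgue (U - (\<Union>i\<in>C. ?B i)) + emeasure lebesgue (\<Union>i\<in>C. ?B i)"
      using U(1) meas by (intro emeasure_subadditive) auto
    also have "emeasure lebesgue (U - (\<Union>i\<in>C. ?B i)) = 0"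
      using C(4) by (intro null_setsD1) (simp add: negligible_iff_null_sets)
    finally show "emeasure lebesgue E \<le> emeasure lebesgue (\<Union>i\<in>C. ?B i)" by simp
  qed simp
  also have "\<dots> = ennreal \<theta> * (\<integral>\<^sup>+i. emeasure lebesgue (?B i) \<partial>count_space C)"
    using emeasure_UN_countable[OF _ C(1) disj1, of lebesgue] by simp
  also have "\<dots> = (\<integral>\<^sup>+i. ennreal \<theta> * emeasure lebesgue (?B i) \<partial>count_space C)"
    by (simp add: nn_integral_cmult)
  also have "\<dots> \<le> (\<integral>\<^sup>+i. emeasure lebesgue (?B i - E) \<partial>count_space C)"
    using ball_le by (intro nn_integral_mono) simp
  also have "\<dots> = emeasure lebesgue (\<Union>i\<in>C. ?B i - E)"
    by (rule emeasure_UN_countable[OF _ C(1) disj2, symmetric]) (use Es in auto)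
  also have "\<dots> \<le> emeasure lebesgue (U - E)"
    using C(2) U(3) by (intro emeasure_mono) auto
  also have "\<dots> < ennreal (\<theta> * measure lebesgue E)" by (rule U(4))
  also have "\<dots> = ennreal \<theta> * emeasure lebesgue E"
    using \<theta> E by (simp add: ennreal_mult emeasure_eq_measure2)
  finally show False by simp
qed

section \<open>Integer-valued functions of bounded variation\<close>

lemma finite_int_bound:
  assumes "finite (V :: int set)"
  obtains K :: real where "0 < K" "\<forall>k\<in>V. \<bar>real_of_int k\<bar> \<le> K"
proof
  show "0 < 1 + (\<Sum>k\<in>V. \<bar>real_of_int k\<bar>)" by (simp add: add_pos_nonneg sum_nonneg)
  show "\<forall>k\<in>V. \<bar>real_of_int k\<bar> \<le> 1 + (\<Sum>k\<in>V. \<bar>real_of_int k\<bar>)"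
  proof
    fix k assume "k \<in> V"
    then have "\<bar>real_of_int k\<bar> \<le> (\<Sum>k\<in>V. \<bar>real_of_int k\<bar>)"
      using assms by (intro member_le_sum) auto
    then show "\<bar>real_of_int k\<bar> \<le> 1 + (\<Sum>k\<in>V. \<bar>real_of_int k\<bar>)" by simp
  qed
qed

lemma BV_values_integrable: "u \<in> BV_values V \<Omega> \<Longrightarrow> integrable (lebesgue_on \<Omega>) u"
  by (simp add: BV_values_def BV_def)

lemma BV_values_AE_bound:
  assumes "u \<in> BV_values V \<Omega>" "\<forall>k\<in>V. \<bar>real_of_int k\<bar> \<le> K"
  shows "AE x in lebesgue_on \<Omega>. \<bar>u x\<bar> \<le> K"
proof -
  have "AE x in lebesgue_on \<Omega>. u x \<in> real_of_int ` V"
    using assms(1) by (simp add: BV_values_def)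
  then show ?thesis by eventually_elim (use assms(2) in auto)
qed

lemma L1_norm_nonneg: "0 \<le> L1_norm \<Omega> u"
  by (simp add: L1_norm_def)

lemma L1_norm_triangle:
  assumes "integrable (lebesgue_on \<Omega>) u" "integrable (lebesgue_on \<Omega>) v" "integrable (lebesgue_on \<Omega>) w"
  shows "L1_norm \<Omega> (\<lambda>x. u x - w x) \<le> L1_norm \<Omega> (\<lambda>x. u x - v x) + L1_norm \<Omega> (\<lambda>x. v x - w x)"
proof -
  have "L1_norm \<Omega> (\<lambda>x. u x - w x)
      \<le> (LINT x|lebesgue_on \<Omega>. \<bar>u x - v x\<bar> + \<bar>v x - w x\<bar>)"
    unfolding L1_norm_def using assms by (intro integral_mono) auto
  then show ?thesis using assms by (simp add: L1_norm_def)
qed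

lemma L1_norm_minus_commute: "L1_norm \<Omega> (\<lambda>x. u x - v x) = L1_norm \<Omega> (\<lambda>x. v x - u x)"
  by (simp add: L1_norm_def abs_minus_commute)

lemma L1_norm_diff_tendsto:
  assumes u: "\<And>n. integrable (lebesgue_on \<Omega>) (u\<^sub>n n)" "integrable (lebesgue_on \<Omega>) u"
    and v: "\<And>n. integrable (lebesgue_on \<Omega>) (v\<^sub>n n)" "integrable (lebesgue_on \<Omega>) v"
    and lim: "(\<lambda>n. L1_norm \<Omega> (\<lambda>x. u\<^sub>n n x - u x)) \<longlonglongrightarrow> 0" "(\<lambda>n. L1_norm \<Omega> (\<lambda>x. v\<^sub>n n x - v x)) \<longlonglongrightarrow> 0"
  shows "(\<lambda>n. L1_norm \<Omega> (\<lambda>x. u\<^sub>n n x - v\<^sub>n n x)) \<longlonglongrightarrow> L1_norm \<Omega> (\<lambda>x. u x - v x)"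
proof (rule LIM_zero_cancel, rule Lim_null_comparison)
  show "(\<lambda>n. L1_norm \<Omega> (\<lambda>x. u\<^sub>n n x - u x) + L1_norm \<Omega> (\<lambda>x. v\<^sub>n n x - v x)) \<longlonglongrightarrow> 0"
    using tendsto_add[OF lim] by simp
  show "\<forall>\<^sub>F n in sequentially. norm (L1_norm \<Omega> (\<lambda>x. u\<^sub>n n x - v\<^sub>n n x) - L1_norm \<Omega> (\<lambda>x. u x - v x))
      \<le> L1_norm \<Omega> (\<lambda>x. u\<^sub>n n x - u x) + L1_norm \<Omega> (\<lambda>x. v\<^sub>n n x - v x)"
  proof (intro always_eventually allI)
    fix n
    show "norm (L1_norm \<Omega> (\<lambda>x. u\<^sub>n n x - v\<^sub>n n x) - L1_norm \<Omega> (\<lambda>x. u x - v x))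
      \<le> L1_norm \<Omega> (\<lambda>x. u\<^sub>n n x - u x) + L1_norm \<Omega> (\<lambda>x. v\<^sub>n n x - v x)"
      using L1_norm_triangle[OF u(1)[of n] u(2) v(1)[of n]] L1_norm_triangle[OF u(2) v(2) v(1)[of n]]
        L1_norm_triangle[OF u(2) u(1)[of n] v(2)] L1_norm_triangle[OF u(1)[of n] v(1)[of n] v(2)]
        L1_norm_minus_commute[of \<Omega> u "u\<^sub>n n"] L1_norm_minus_commute[of \<Omega> v "v\<^sub>n n"]
      by (simp add: abs_le_iff)
  qed
qed

lemma BV_values_square_integrable:
  assumes "\<Omega> \<in> lmeasurable" "finite V" "u \<in> BV_values V \<Omega>"
  shows "square_integrable (lebesgue_on \<Omega>) u"
proof -
  obtain K where K: "0 < K" "\<forall>k\<in>V. \<bar>real_of_int k\<bar> \<le> K"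
    using finite_int_bound[OF assms(2)] by blast
  have u: "u \<in> borel_measurable (lebesgue_on \<Omega>)" using BV_values_integrable[OF assms(3)] by simp
  have "integrable (lebesgue_on \<Omega>) (\<lambda>x. (u x)\<^sup>2)"
  proof (rule Bochner_Integration.integrable_bound[OF integrable_const_lebesgue_on[OF assms(1), of "K\<^sup>2"]])
    show "AE x in lebesgue_on \<Omega>. norm ((u x)\<^sup>2) \<le> norm (K\<^sup>2)"
      using BV_values_AE_bound[OF assms(3) K(2)]
    proof eventually_elim
      case (elim x)
      then have "\<bar>u x\<bar>\<^sup>2 \<le> K\<^sup>2" by (intro power_mono) auto
      then show ?case by simp
    qed
  qed (use u in simp)
  with u show ?thesis by (simp add: square_integrable_def)
qed

text \<open>
  Functions with values in \<open>V\<close> share a bound \<open>K\<close>, so that \<open>\<bar>u\<^sub>n - u\<bar>\<^sup>2 \<le> 2 K \<bar>u\<^sub>n - u\<bar>\<close>.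
\<close>

lemma BV_values_L1_imp_L2_tendsto:
  assumes \<Omega>: "\<Omega> \<in> lmeasurable" and V: "finite V"
    and u: "\<And>n. u\<^sub>n n \<in> BV_values V \<Omega>" "u \<in> BV_values V \<Omega>"
    and lim: "(\<lambda>n. L1_norm \<Omega> (\<lambda>x. u\<^sub>n n x - u x)) \<longlonglongrightarrow> 0"
  shows "(\<lambda>n. LINT x|lebesgue_on \<Omega>. (u\<^sub>n n x - u x)\<^sup>2) \<longlonglongrightarrow> 0"
proof -
  let ?M = "lebesgue_on \<Omega>"
  obtain K where K: "0 < K" "\<forall>k\<in>V. \<bar>real_of_int k\<bar> \<le> K"
    using finite_int_bound[OF V] by blast
  have le: "(LINT x|?M. (u\<^sub>n n x - u x)\<^sup>2) \<le> 2 * K * L1_norm \<Omega> (\<lambda>x. u\<^sub>n n x - u x)" for n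
  proof -
    have "(LINT x|?M. (u\<^sub>n n x - u x)\<^sup>2) \<le> (LINT x|?M. 2 * K * \<bar>u\<^sub>n n x - u x\<bar>)"
    proof (rule integral_mono_AE)
      show "integrable ?M (\<lambda>x. (u\<^sub>n n x - u x)\<^sup>2)"
        using square_integrable_diff[OF BV_values_square_integrable[OF \<Omega> V u(1)] BV_values_square_integrable[OF \<Omega> V u(2)]]
        by (simp add: square_integrable_def)
      show "integrable ?M (\<lambda>x. 2 * K * \<bar>u\<^sub>n n x - u x\<bar>)"
        using BV_values_integrable[OF u(1)] BV_values_integrable[OF u(2)] by simp
      show "AE x in ?M. (u\<^sub>n n x - u x)\<^sup>2 \<le> 2 * K * \<bar>u\<^sub>n n x - u x\<bar>"
        using BV_values_AE_bound[OF u(1) K(2), of n] BV_values_AE_bound[OF u(2) K(2)]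
      proof eventually_elim
        case (elim x)
        then have "\<bar>u\<^sub>n n x - u x\<bar> \<le> 2 * K" by linarith
        then have "\<bar>u\<^sub>n n x - u x\<bar> * \<bar>u\<^sub>n n x - u x\<bar> \<le> 2 * K * \<bar>u\<^sub>n n x - u x\<bar>"
          by (intro mult_right_mono) auto
        then show ?case by (simp add: power2_eq_square)
      qed
    qed
    then show ?thesis by (simp add: L1_norm_def)
  qed
  show ?thesis
  proof (rule tendsto_sandwich[OF _ _ tendsto_const tendsto_mult_right_zero[OF lim, of "2 * K"]])
    show "\<forall>\<^sub>F n in sequentially. 0 \<le> (LINT x|?M. (u\<^sub>n n x - u x)\<^sup>2)" by simp
    show "\<forall>\<^sub>F n in sequentially. (LINT x|?M. (u\<^sub>n n x - u x)\<^sup>2) \<le> 2 * K * L1_norm \<Omega> (\<lambda>x. u\<^sub>n n x - u x)"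
      using le by simp
  qed
qed

lemma L2_inner_tendsto:
  assumes \<Omega>: "\<Omega> \<in> lmeasurable" and V: "finite V"
    and g: "L2_weakly_converges \<Omega> g\<^sub>n g"
    and u: "\<And>n. u\<^sub>n n \<in> BV_values V \<Omega>" "u \<in> BV_values V \<Omega>"
      "(\<lambda>n. L1_norm \<Omega> (\<lambda>x. u\<^sub>n n x - u x)) \<longlonglongrightarrow> 0"
  shows "(\<lambda>n. L2_inner \<Omega> (g\<^sub>n n) (u\<^sub>n n)) \<longlonglongrightarrow> L2_inner \<Omega> g u"
  unfolding L2_inner_def
proof (rule weak_strong_product)
  have L2: "h \<in> L2_space \<Omega> \<longleftrightarrow> square_integrable (lebesgue_on \<Omega>) h" for h
    by (simp add: L2_space_def square_integrable_def)
  show "square_integrable (lebesgue_on \<Omega>) (g\<^sub>n n)" "square_integrable (lebesgue_on \<Omega>) g" for n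
    using g by (auto simp: L2_weakly_converges_def L2)
  show "square_integrable (lebesgue_on \<Omega>) (u\<^sub>n n)" "square_integrable (lebesgue_on \<Omega>) u" for n
    using u by (auto intro: BV_values_square_integrable \<Omega> V)
  show "(\<lambda>n. LINT x|lebesgue_on \<Omega>. g\<^sub>n n x * h x) \<longlonglongrightarrow> (LINT x|lebesgue_on \<Omega>. g x * h x)"
    if "square_integrable (lebesgue_on \<Omega>) h" for h
  proof -
    have "h \<in> L2_space \<Omega>" using that by (simp add: L2)
    then show ?thesis using g unfolding L2_weakly_converges_def L2_inner_def by blast
  qed
  show "(\<lambda>n. LINT x|lebesgue_on \<Omega>. (u\<^sub>n n x - u x)\<^sup>2) \<longlonglongrightarrow> 0"
    by (rule BV_values_L1_imp_L2_tendsto[OF \<Omega> V u])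
qed

section \<open>Competitors strictly inside the trust region\<close>

text \<open>
  Shifting by \<open>b\<close> reduces the change of value to setting a function bounded by \<open>2 K\<close> to zero.
\<close>

lemma BV_values_set_const_on_ball:
  fixes c :: "'a::euclidean_space"
  assumes \<Omega>: "\<Omega> \<in> lmeasurable" and w: "w \<in> BV_values V \<Omega>"
    and K: "\<forall>k\<in>V. \<bar>real_of_int k\<bar> \<le> K" and b: "b \<in> V" and r: "0 < r"
    and w': "w' = (\<lambda>x. if x \<in> cball c r then real_of_int b else w x)"
  shows "w' \<in> BV_values V \<Omega>"
    and "TV \<Omega> w' \<le> TV \<Omega> w
      + ereal (2 * K * (4 * (unit_ball_vol DIM('a) * DIM('a) * (2 * r) ^ (DIM('a) - 1))))"
    and "L1_norm \<Omega> (\<lambda>x. w' x - w x) \<le> 2 * K * (unit_ball_vol DIM('a) * r ^ DIM('a))"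
proof -
  let ?M = "lebesgue_on \<Omega>"
  have \<Omega>s: "\<Omega> \<in> sets lebesgue" using \<Omega> by (rule fmeasurableD)
  have K0: "0 \<le> K" using bspec[OF K b] by simp
  have wi: "integrable ?M w" by (rule BV_values_integrable[OF w])
  have AEK: "AE x in ?M. \<bar>w x\<bar> \<le> K" using w K by (rule BV_values_AE_bound)
  have AE2K: "AE x in ?M. \<bar>w x - real_of_int b\<bar> \<le> 2 * K"
    using AEK by eventually_elim (use bspec[OF K b] in linarith)
  have wb: "integrable ?M (\<lambda>x. w x - real_of_int b)"
    using wi integrable_const_lebesgue_on[OF \<Omega>] by (rule Bochner_Integration.integrable_diff)
  have B: "cball c r \<in> lmeasurable" by simp
  note ind = integral_indicator_lebesgue_on[OF \<Omega>s B]
  have im: "(indicator (cball c r) :: 'a \<Rightarrow> real) \<in> borel_measurable ?M"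
    using ind(1) by simp
  let ?z = "\<lambda>x. if x \<in> cball c r then 0 else w x - real_of_int b"
  have zi: "integrable ?M ?z"
  proof (rule Bochner_Integration.integrable_bound[OF wb])
    have "?z = (\<lambda>x. (w x - real_of_int b) - indicator (cball c r) x * (w x - real_of_int b))"
      by (auto simp: indicator_def)
    then show "?z \<in> borel_measurable ?M" using wi im by simp
  qed auto
  have w'z: "w' = (\<lambda>x. ?z x + real_of_int b)" by (auto simp: w')
  have w'i: "integrable ?M w'"
    unfolding w'z using zi integrable_const_lebesgue_on[OF \<Omega>] by (rule Bochner_Integration.integrable_add)
  have "TV \<Omega> w' = TV \<Omega> ?z" unfolding w'z by (rule TV_add_const[OF \<Omega> zi])
  also have "\<dots> \<le> TV \<Omega> (\<lambda>x. w x - real_of_int b)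
      + ereal (2 * K * (4 * (unit_ball_vol DIM('a) * DIM('a) * (2 * r) ^ (DIM('a) - 1))))"
    using K0 by (intro TV_set_zero_on_ball \<Omega> wb AE2K r) auto
  also have "TV \<Omega> (\<lambda>x. w x - real_of_int b) = TV \<Omega> w"
    using TV_add_const[OF \<Omega> wi, of "- real_of_int b"] by simp
  finally show TV: "TV \<Omega> w' \<le> TV \<Omega> w
      + ereal (2 * K * (4 * (unit_ball_vol DIM('a) * DIM('a) * (2 * r) ^ (DIM('a) - 1))))" .
  have "TV \<Omega> w < \<infinity>" using w by (simp add: BV_values_def BV_def)
  with TV have "TV \<Omega> w' < \<infinity>" by (cases "TV \<Omega> w") auto
  moreover have "AE x in ?M. w' x \<in> real_of_int ` V"
  proof -
    have "AE x in ?M. w x \<in> real_of_int ` V" using w by (simp add: BV_values_def)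
    then show ?thesis by eventually_elim (use b in \<open>auto simp: w'\<close>)
  qed
  ultimately show "w' \<in> BV_values V \<Omega>" using w'i by (simp add: BV_values_def BV_def)
  have "L1_norm \<Omega> (\<lambda>x. w' x - w x) \<le> (LINT x|?M. 2 * K * indicator (cball c r) x)"
    unfolding L1_norm_def
  proof (rule integral_mono_AE)
    show "integrable ?M (\<lambda>x. \<bar>w' x - w x\<bar>)" using w'i wi by simp
    show "integrable ?M (\<lambda>x. 2 * K * indicator (cball c r) x)"
      using ind(1) by (rule integrable_mult_right)
    show "AE x in ?M. \<bar>w' x - w x\<bar> \<le> 2 * K * indicator (cball c r) x"
      using AE2K by eventually_elim (auto simp: w' indicator_def abs_minus_commute)
  qed
  also have "\<dots> = 2 * K * (LINT x|?M. indicator (cball c r) x)" by simp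
  also have "\<dots> \<le> 2 * K * measure lebesgue (cball c r)"
    using K0 ind(3) by (intro mult_left_mono) auto
  also have "measure lebesgue (cball c r) = unit_ball_vol DIM('a) * r ^ DIM('a)"
    using content_cball[of r c] r by simp
  finally show "L1_norm \<Omega> (\<lambda>x. w' x - w x) \<le> 2 * K * (unit_ball_vol DIM('a) * r ^ DIM('a))" .
qed

text \<open>
  The values of \<open>w\<close> are replaced by \<open>b\<close> on a small ball that is almost filled by a set where
  \<open>w = a \<noteq> b = v\<close>.  On this set the integrand \<open>\<bar>w - v\<bar>\<close> drops from at least \<open>1\<close>, the values being
  integers, to \<open>0\<close>; on the remaining fraction \<open>\<theta>\<close> of the ball it grows by at most \<open>2 K\<close>.
\<close>

lemma closer_competitor:
  fixes \<Omega> :: "'a::euclidean_space set"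
  assumes dim: "DIM('a) \<ge> 2" and \<Omega>: "\<Omega> \<in> lmeasurable" and V: "finite V"
    and w: "w \<in> BV_values V \<Omega>" and v: "v \<in> BV_values V \<Omega>"
    and pos: "0 < L1_norm \<Omega> (\<lambda>x. w x - v x)" and e: "0 < e"
  obtains w' where "w' \<in> BV_values V \<Omega>" "L1_norm \<Omega> (\<lambda>x. w' x - w x) \<le> e"
    "TV \<Omega> w' \<le> TV \<Omega> w + ereal e" "L1_norm \<Omega> (\<lambda>x. w' x - v x) < L1_norm \<Omega> (\<lambda>x. w x - v x)"
proof -
  let ?M = "lebesgue_on \<Omega>"
  have \<Omega>s: "\<Omega> \<in> sets lebesgue" using \<Omega> by (rule fmeasurableD)
  obtain K where K: "0 < K" "\<forall>k\<in>V. \<bar>real_of_int k\<bar> \<le> K"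
    using finite_int_bound[OF V] by blast
  have wi: "integrable ?M w" and vi: "integrable ?M v"
    using w v by (auto intro: BV_values_integrable)
  have wm: "w \<in> borel_measurable ?M" and vm: "v \<in> borel_measurable ?M" using wi vi by auto
  have wV: "AE x in ?M. w x \<in> real_of_int ` V" and vV: "AE x in ?M. v x \<in> real_of_int ` V"
    using w v by (auto simp: BV_values_def)
  define P where "P = (\<lambda>a b. {x \<in> space ?M. w x = real_of_int a \<and> v x = real_of_int b})"
  have Ps: "P a b \<in> sets ?M" for a b unfolding P_def using wm vm by measurable
  have P\<Omega>: "P a b \<subseteq> \<Omega>" for a b by (auto simp: P_def)
  have Psl: "P a b \<in> sets lebesgue" for a b
    using Ps[of a b] \<Omega>s by (auto simp: sets_restrict_space_iff)
  have Pl: "P a b \<in> lmeasurable" for a b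
    by (rule fmeasurableI2[OF \<Omega> P\<Omega> Psl])
  \<comment> \<open>Otherwise \<open>w\<close> and \<open>v\<close> agree almost everywhere, as \<open>V\<close> has only finitely many pairs of values.\<close>
  have "\<exists>a\<in>V. \<exists>b\<in>V. a \<noteq> b \<and> 0 < measure lebesgue (P a b)"
  proof (rule ccontr)
    assume no: "\<not> ?thesis"
    have null: "AE x in ?M. a \<noteq> b \<longrightarrow> x \<notin> P a b" if "a \<in> V" "b \<in> V" for a b
    proof (cases "a = b")
      case False
      with no that have "measure lebesgue (P a b) = 0"
        using measure_nonneg[of lebesgue "P a b"] by (metis less_eq_real_def)
      then have "emeasure lebesgue (P a b) = 0"
        by (simp only: emeasure_eq_measure2[OF Pl] ennreal_0)
      moreover have "emeasure ?M (P a b) = emeasure lebesgue (P a b)"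
        using \<Omega>s P\<Omega> by (intro emeasure_restrict_space) auto
      ultimately have "P a b \<in> null_sets ?M" using Ps by (intro null_setsI) auto
      from AE_not_in[OF this] show ?thesis by eventually_elim simp
    qed simp
    have "AE x in ?M. \<forall>a\<in>V. \<forall>b\<in>V. a \<noteq> b \<longrightarrow> x \<notin> P a b"
      using V null by (intro AE_finite_allI) auto
    then have "AE x in ?M. w x = v x"
      using wV vV AE_space by eventually_elim (force simp: P_def)
    then have "L1_norm \<Omega> (\<lambda>x. w x - v x) = (LINT x|?M. 0)"
      unfolding L1_norm_def using wm vm by (intro integral_cong_AE) auto
    then show False using pos by simp
  qed
  then obtain a b where ab: "a \<in> V" "b \<in> V" "a \<noteq> b" "0 < measure lebesgue (P a b)" by blast
  define E where "E = P a b"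
  have E: "E \<in> lmeasurable" "0 < measure lebesgue E" "E \<subseteq> \<Omega>" using ab Pl P\<Omega> by (auto simp: E_def)
  \<comment> \<open>With this \<open>\<theta>\<close> the balance \<open>1 - \<theta> - 2 K \<theta>\<close> of gain and loss per unit volume equals \<open>1/2\<close>.\<close>
  define \<theta> where "\<theta> = 1 / (2 * (1 + 2 * K))"
  have \<theta>: "0 < \<theta>" using K by (simp add: \<theta>_def)
  define \<omega> where "\<omega> = unit_ball_vol DIM('a)"
  have \<omega>: "0 < \<omega>" by (simp add: \<omega>_def)
  \<comment> \<open>For \<open>r \<le> 1\<close> and \<open>d \<ge> 2\<close>, both \<open>r^d\<close> and \<open>r^(d - 1)\<close> are at most \<open>r\<close>, so \<open>Q r\<close> dominates the
    change in \<open>L\<^sup>1\<close> and the increase of the total variation.\<close>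
  define Q where "Q = 2 * K * (\<omega> + 4 * \<omega> * DIM('a) * 2 ^ (DIM('a) - 1))"
  have Q: "0 \<le> Q" using K \<omega> by (simp add: Q_def)
  define \<rho> where "\<rho> = min 1 (e / (Q + 1))"
  have \<rho>: "0 < \<rho>" using e Q by (simp add: \<rho>_def)
  obtain c r where r: "0 < r" "r < \<rho>"
    and dens: "measure lebesgue (cball c r - E) \<le> \<theta> * measure lebesgue (cball c r)"
    using exists_small_ball_mostly_in[OF E(1,2) \<theta> \<rho>] by blast
  have r1: "r < 1" and rQ: "Q * r \<le> e"
  proof -
    show "r < 1" using r by (simp add: \<rho>_def)
    have "r * (Q + 1) < e" using r Q by (simp add: \<rho>_def pos_less_divide_eq)
    then show "Q * r \<le> e" using r by (simp add: algebra_simps)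
  qed
  have rp: "r ^ n \<le> r" if "1 \<le> n" for n
    using power_decreasing[OF that, of r] r r1 by simp
  define w' where "w' = (\<lambda>x. if x \<in> cball c r then real_of_int b else w x)"
  note C = BV_values_set_const_on_ball[OF \<Omega> w K(2) ab(2) r(1) w'_def, folded \<omega>_def]
  have "L1_norm \<Omega> (\<lambda>x. w' x - w x) \<le> e"
  proof -
    have "2 * K * (\<omega> * r ^ DIM('a)) \<le> 2 * K * (\<omega> * r)"
      using K \<omega> rp[of "DIM('a)"] dim by (intro mult_left_mono) auto
    also have "\<dots> \<le> Q * r" using K \<omega> r by (simp add: Q_def algebra_simps)
    finally show ?thesis using C(3) rQ by linarith
  qed
  moreover have "TV \<Omega> w' \<le> TV \<Omega> w + ereal e"
  proof -
    have "2 * K * (4 * (\<omega> * DIM('a) * (2 * r) ^ (DIM('a) - 1)))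
        = 2 * K * (4 * \<omega> * DIM('a) * 2 ^ (DIM('a) - 1)) * r ^ (DIM('a) - 1)"
      by (simp add: power_mult_distrib mult_ac)
    also have "\<dots> \<le> 2 * K * (4 * \<omega> * DIM('a) * 2 ^ (DIM('a) - 1)) * r"
      using K \<omega> rp[of "DIM('a) - 1"] dim by (intro mult_left_mono) auto
    also have "\<dots> \<le> Q * r" using K \<omega> r by (simp add: Q_def algebra_simps)
    finally have "2 * K * (4 * (\<omega> * DIM('a) * (2 * r) ^ (DIM('a) - 1))) \<le> e" using rQ by linarith
    then have "TV \<Omega> w + ereal (2 * K * (4 * (\<omega> * DIM('a) * (2 * r) ^ (DIM('a) - 1)))) \<le> TV \<Omega> w + ereal e"
      by (intro add_left_mono) simp
    with C(2) show ?thesis by (rule order_trans)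
  qed
  moreover have "L1_norm \<Omega> (\<lambda>x. w' x - v x) < L1_norm \<Omega> (\<lambda>x. w x - v x)"
  proof -
    define B where "B = cball c r"
    have Bl: "B \<in> lmeasurable" by (simp add: B_def)
    have mB: "0 < measure lebesgue B"
      using content_cball[of r c] r by (simp add: B_def)
    have EB: "E \<inter> B \<in> lmeasurable" "B - E \<in> lmeasurable"
      using E(1) Bl by (auto intro: fmeasurable_Diff)
    note i1 = integral_indicator_lebesgue_on[OF \<Omega>s EB(1)]
    note i2 = integral_indicator_lebesgue_on[OF \<Omega>s EB(2)]
    have w'i: "integrable ?M w'" using C(1) by (rule BV_values_integrable)
    have "measure lebesgue B = measure lebesgue (E \<inter> B) + measure lebesgue (B - E)"
    proof -
      have "B - E = B - E \<inter> B" by blast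
      then show ?thesis
        using measurable_measure_Diff[OF Bl fmeasurableD[OF EB(1)]] by simp
    qed
    then have big: "(1 - \<theta>) * measure lebesgue B \<le> measure lebesgue (E \<inter> B)"
      using dens by (simp add: B_def algebra_simps)
    have "2 * K * measure lebesgue (B - E) \<le> 2 * K * (\<theta> * measure lebesgue B)"
      using dens K by (intro mult_left_mono) (auto simp: B_def)
    with big have "measure lebesgue (E \<inter> B) - 2 * K * measure lebesgue (B - E)
        \<ge> (1 - \<theta> * (1 + 2 * K)) * measure lebesgue B"
      by (simp add: algebra_simps)
    also have "1 - \<theta> * (1 + 2 * K) = 1 / 2" using K by (simp add: \<theta>_def)
    finally have "0 < measure lebesgue (E \<inter> B) - 2 * K * measure lebesgue (B - E)"
      using mB by linarith
    also have "\<dots> \<le> (LINT x|?M. indicator (E \<inter> B) x) - 2 * K * (LINT x|?M. indicator (B - E) x)"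
    proof -
      have "E \<inter> B \<inter> \<Omega> = E \<inter> B" using E(3) by blast
      then have "(LINT x|?M. indicator (E \<inter> B) x) = measure lebesgue (E \<inter> B)" using i1(2) by simp
      moreover have "2 * K * (LINT x|?M. indicator (B - E) x) \<le> 2 * K * measure lebesgue (B - E)"
        using i2(3) K by (intro mult_left_mono) auto
      ultimately show ?thesis by linarith
    qed
    also have "\<dots> = (LINT x|?M. indicator (E \<inter> B) x - 2 * K * indicator (B - E) x)"
      using i1(1) i2(1) by simp
    also have "\<dots> \<le> (LINT x|?M. \<bar>w x - v x\<bar> - \<bar>w' x - v x\<bar>)"
    proof (rule integral_mono_AE)
      show "integrable ?M (\<lambda>x. indicator (E \<inter> B) x - 2 * K * indicator (B - E) x)"
        by (intro Bochner_Integration.integrable_diff integrable_mult_right i1(1) i2(1))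
      show "integrable ?M (\<lambda>x. \<bar>w x - v x\<bar> - \<bar>w' x - v x\<bar>)" using wi vi w'i by simp
      show "AE x in ?M. indicator (E \<inter> B) x - 2 * K * indicator (B - E) x
          \<le> \<bar>w x - v x\<bar> - \<bar>w' x - v x\<bar>"
        using BV_values_AE_bound[OF v K(2)]
      proof eventually_elim
        case (elim x)
        consider "x \<notin> B" | "x \<in> B" "x \<in> E" | "x \<in> B" "x \<notin> E" by blast
        then show ?case
        proof cases
          case 1
          then show ?thesis by (simp add: w'_def B_def)
        next
          case 2
          have "1 \<le> \<bar>a - b\<bar>" using ab(3) by linarith
          then have "1 \<le> \<bar>real_of_int a - real_of_int b\<bar>" by linarith
          with 2 show ?thesis by (simp add: w'_def B_def E_def P_def)
        next
          case 3
          have "\<bar>real_of_int b - v x\<bar> \<le> 2 * K" using elim bspec[OF K(2) ab(2)] by linarith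
          with 3 show ?thesis by (simp add: w'_def B_def)
        qed
      qed
    qed
    also have "\<dots> = L1_norm \<Omega> (\<lambda>x. w x - v x) - L1_norm \<Omega> (\<lambda>x. w' x - v x)"
      unfolding L1_norm_def using wi vi w'i by (intro Bochner_Integration.integral_diff) auto
    finally show ?thesis by simp
  qed
  ultimately show ?thesis using that C(1) by blast
qed

text \<open>
  Only a \<open>w\<close> on the boundary of the trust region has to be modified.
\<close>

lemma competitors_in_open_trust_region:
  fixes \<Omega> :: "'a::euclidean_space set"
  assumes dim: "DIM('a) \<ge> 2" and \<Omega>: "\<Omega> \<in> lmeasurable" and V: "finite V"
    and w: "w \<in> BV_values V \<Omega>" and v: "v \<in> BV_values V \<Omega>"
    and \<Delta>: "0 < \<Delta>" "L1_norm \<Omega> (\<lambda>x. w x - v x) \<le> \<Delta>" and e: "0 < e"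
  shows "\<exists>w'. w' \<in> BV_values V \<Omega> \<and> L1_norm \<Omega> (\<lambda>x. w' x - w x) \<le> e \<and>
    TV \<Omega> w' \<le> TV \<Omega> w + ereal e \<and> L1_norm \<Omega> (\<lambda>x. w' x - v x) < \<Delta>"
proof (cases "L1_norm \<Omega> (\<lambda>x. w x - v x) < \<Delta>")
  case True
  have "TV \<Omega> w \<le> TV \<Omega> w + ereal e" using e by (cases "TV \<Omega> w") auto
  with True w e show ?thesis by (intro exI[of _ w]) (simp add: L1_norm_def)
next
  case False
  then have "0 < L1_norm \<Omega> (\<lambda>x. w x - v x)" using \<Delta> by simp
  then obtain w' where "w' \<in> BV_values V \<Omega>" "L1_norm \<Omega> (\<lambda>x. w' x - w x) \<le> e"
    "TV \<Omega> w' \<le> TV \<Omega> w + ereal e" "L1_norm \<Omega> (\<lambda>x. w' x - v x) < L1_norm \<Omega> (\<lambda>x. w x - v x)"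
    by (rule closer_competitor[OF dim \<Omega> V w v _ e])
  with \<Delta>(2) show ?thesis by (intro exI[of _ w']) simp
qed

section \<open>Gamma-convergence of the trust-region functionals\<close>

text \<open>
  The largest \<open>k \<le> n\<close> for which \<open>P k n\<close> holds is taken as the index for \<open>n\<close>.
\<close>

lemma diagonal_selection:
  fixes P :: "nat \<Rightarrow> nat \<Rightarrow> bool"
  assumes ev: "\<And>k. \<forall>\<^sub>F n in sequentially. P k n"
  obtains \<kappa> where "filterlim \<kappa> at_top sequentially" "\<forall>\<^sub>F n in sequentially. P (\<kappa> n) n"
proof
  define S where "S = (\<lambda>n. {k. k \<le> n \<and> P k n})"
  have fin: "finite (S n)" for n by (rule finite_subset[of _ "{..n}"]) (auto simp: S_def)
  have evS: "\<forall>\<^sub>F n in sequentially. k \<in> S n" for k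
    using ev[of k] eventually_ge_at_top[of k] by eventually_elim (simp add: S_def)
  show "filterlim (\<lambda>n. Max (S n)) at_top sequentially"
    unfolding filterlim_at_top
  proof
    fix k
    show "\<forall>\<^sub>F n in sequentially. k \<le> Max (S n)"
      using evS[of k] by eventually_elim (rule Max_ge[OF fin])
  qed
  show "\<forall>\<^sub>F n in sequentially. P (Max (S n)) n"
    using evS[of 0]
  proof eventually_elim
    case (elim n)
    then have "Max (S n) \<in> S n" using fin by (intro Max_in) auto
    then show ?case by (simp add: S_def)
  qed
qed

lemma BV_TV_finite:
  assumes "u \<in> BV \<Omega>"
  shows "TV \<Omega> u = ereal (real_of_ereal (TV \<Omega> u))"
  using assms TV_nonneg[of \<Omega> u] by (cases "TV \<Omega> u") (auto simp: BV_def)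

text \<open>
  All terms but \<open>TV w\<close> and the constraint are collected into one real number, so that no
  subtraction of extended reals is left.
\<close>

lemma TR_functional_eq:
  assumes "v \<in> BV \<Omega>" "w \<in> BV \<Omega>"
  shows "TR_functional \<Omega> \<alpha> \<Delta> g v w
    = ereal (L2_inner \<Omega> g (\<lambda>x. w x - v x) - \<alpha> * real_of_ereal (TV \<Omega> v)) + ereal \<alpha> * TV \<Omega> w
      + indicator_infty {0..\<Delta>} (L1_norm \<Omega> (\<lambda>x. w x - v x))"
proof -
  obtain s t where "TV \<Omega> v = ereal s" "TV \<Omega> w = ereal t"
    using BV_TV_finite assms by blast
  then show ?thesis by (simp add: TR_functional_def algebra_simps)
qed

theorem theorem5p2:
  fixes \<Omega> :: "'a::euclidean_space set"
    and V :: "int set"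
    and \<alpha> \<Delta> :: real
    and v\<^sub>n :: "nat \<Rightarrow> 'a \<Rightarrow> real" and v :: "'a \<Rightarrow> real"
    and g\<^sub>n :: "nat \<Rightarrow> 'a \<Rightarrow> real" and g :: "'a \<Rightarrow> real"
  assumes "DIM('a) \<ge> 2"
    and "bounded_lipschitz_domain \<Omega>"
    and "finite V"
    and "\<alpha> > 0"
    and "\<Delta> > 0"
    and "\<And>n. v\<^sub>n n \<in> BV_values V \<Omega>"
    and "v \<in> BV_values V \<Omega>"
    and "strictly_converges \<Omega> v\<^sub>n v"
    and "L2_weakly_converges \<Omega> g\<^sub>n g"
  shows "Gamma_converges (BV_values V \<Omega>) (weak_star_converges \<Omega>)
           (\<lambda>n. TR_functional \<Omega> \<alpha> \<Delta> (g\<^sub>n n) (v\<^sub>n n))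
           (TR_functional \<Omega> \<alpha> \<Delta> g v)"
proof -
  note V = assms(3) and \<alpha> = assms(4) and \<Delta> = assms(5) and vn = assms(6) and v = assms(7) and g = assms(9)
  have \<Omega>: "\<Omega> \<in> lmeasurable"
    using assms(2) by (auto simp: bounded_lipschitz_domain_def intro: lmeasurable_open)
  have BVV: "u \<in> BV \<Omega>" if "u \<in> BV_values V \<Omega>" for u
    using that by (simp add: BV_values_def)
  note int = BV_values_integrable
  have vlim: "(\<lambda>n. L1_norm \<Omega> (\<lambda>x. v\<^sub>n n x - v x)) \<longlonglongrightarrow> 0" and TVlim: "(\<lambda>n. TV \<Omega> (v\<^sub>n n)) \<longlonglongrightarrow> TV \<Omega> v"
    using assms(8) by (auto simp: strictly_converges_def)
  define s\<^sub>n where "s\<^sub>n = (\<lambda>n. real_of_ereal (TV \<Omega> (v\<^sub>n n)))"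
  define s where "s = real_of_ereal (TV \<Omega> v)"
  have s: "TV \<Omega> (v\<^sub>n n) = ereal (s\<^sub>n n)" "TV \<Omega> v = ereal s" for n
    unfolding s\<^sub>n_def s_def by (intro BV_TV_finite BVV vn v)+
  have slim: "s\<^sub>n \<longlonglongrightarrow> s" using TVlim by (simp add: s)
  define J where "J = (\<lambda>w n. L2_inner \<Omega> (g\<^sub>n n) (\<lambda>x. w x - v\<^sub>n n x))"
  have inner_lim: "(\<lambda>n. J (w\<^sub>n n) n) \<longlonglongrightarrow> L2_inner \<Omega> g (\<lambda>x. w x - v x)"
    if w: "\<And>n. w\<^sub>n n \<in> BV_values V \<Omega>" "w \<in> BV_values V \<Omega>"
      "(\<lambda>n. L1_norm \<Omega> (\<lambda>x. w\<^sub>n n x - w x)) \<longlonglongrightarrow> 0" for w\<^sub>n w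
  proof -
    have "L2_inner \<Omega> h (\<lambda>x. u x - u' x) = L2_inner \<Omega> h u - L2_inner \<Omega> h u'"
      if "h \<in> L2_space \<Omega>" "u \<in> BV_values V \<Omega>" "u' \<in> BV_values V \<Omega>" for h u u'
    proof -
      have "square_integrable (lebesgue_on \<Omega>) h" using that(1) by (simp add: L2_space_def square_integrable_def)
      moreover have "square_integrable (lebesgue_on \<Omega>) u" "square_integrable (lebesgue_on \<Omega>) u'"
        using that(2,3) by (auto intro: BV_values_square_integrable[OF \<Omega> V])
      ultimately show ?thesis
        unfolding L2_inner_def right_diff_distrib
        by (intro Bochner_Integration.integral_diff square_integrable_mult)
    qed
    moreover have "\<And>n. g\<^sub>n n \<in> L2_space \<Omega>" "g \<in> L2_space \<Omega>"
      using g by (auto simp: L2_weakly_converges_def)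
    ultimately show ?thesis
      unfolding J_def
      using tendsto_diff[OF L2_inner_tendsto[OF \<Omega> V g w] L2_inner_tendsto[OF \<Omega> V g vn v vlim]] w vn v
      by simp
  qed
  have dist_lim: "(\<lambda>n. L1_norm \<Omega> (\<lambda>x. w\<^sub>n n x - v\<^sub>n n x)) \<longlonglongrightarrow> L1_norm \<Omega> (\<lambda>x. w x - v x)"
    if "\<And>n. w\<^sub>n n \<in> BV_values V \<Omega>" "w \<in> BV_values V \<Omega>"
      "(\<lambda>n. L1_norm \<Omega> (\<lambda>x. w\<^sub>n n x - w x)) \<longlonglongrightarrow> 0" for w\<^sub>n w
    by (rule L1_norm_diff_tendsto) (use that vn v vlim in \<open>auto intro: int\<close>)
  have Tn: "TR_functional \<Omega> \<alpha> \<Delta> (g\<^sub>n n) (v\<^sub>n n) w = ereal (J w n - \<alpha> * s\<^sub>n n) + ereal \<alpha> * TV \<Omega> w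
      + indicator_infty {0..\<Delta>} (L1_norm \<Omega> (\<lambda>x. w x - v\<^sub>n n x))" if "w \<in> BV_values V \<Omega>" for w n
    unfolding TR_functional_eq[OF BVV[OF vn] BVV[OF that]] by (simp add: J_def s\<^sub>n_def)
  have T: "TR_functional \<Omega> \<alpha> \<Delta> g v w = ereal (L2_inner \<Omega> g (\<lambda>x. w x - v x) - \<alpha> * s) + ereal \<alpha> * TV \<Omega> w
      + indicator_infty {0..\<Delta>} (L1_norm \<Omega> (\<lambda>x. w x - v x))" if "w \<in> BV_values V \<Omega>" for w
    unfolding TR_functional_eq[OF BVV[OF v] BVV[OF that]] by (simp add: s_def)
  have lower: "TR_functional \<Omega> \<alpha> \<Delta> g v w \<le> liminf (\<lambda>n. TR_functional \<Omega> \<alpha> \<Delta> (g\<^sub>n n) (v\<^sub>n n) (w\<^sub>n n))"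
    if w: "\<And>n. w\<^sub>n n \<in> BV_values V \<Omega>" "w \<in> BV_values V \<Omega>" "weak_star_converges \<Omega> w\<^sub>n w" for w\<^sub>n w
  proof -
    have wlim: "(\<lambda>n. L1_norm \<Omega> (\<lambda>x. w\<^sub>n n x - w x)) \<longlonglongrightarrow> 0"
      using w(3) by (simp add: weak_star_converges_def)
    note L = dist_lim[OF w(1,2) wlim]
    let ?I = "L2_inner \<Omega> g (\<lambda>x. w x - v x)"
    show ?thesis
    proof (cases "L1_norm \<Omega> (\<lambda>x. w x - v x) \<le> \<Delta>")
      case False
      then have "\<forall>\<^sub>F n in sequentially. \<Delta> < L1_norm \<Omega> (\<lambda>x. w\<^sub>n n x - v\<^sub>n n x)"
        by (intro order_tendstoD(1)[OF L]) simp
      then have "\<forall>\<^sub>F n in sequentially. TR_functional \<Omega> \<alpha> \<Delta> (g\<^sub>n n) (v\<^sub>n n) (w\<^sub>n n) = \<infinity>"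
      proof eventually_elim
        case (elim n)
        have "TV \<Omega> (w\<^sub>n n) = ereal (real_of_ereal (TV \<Omega> (w\<^sub>n n)))" by (rule BV_TV_finite[OF BVV[OF w(1)]])
        then obtain t where "TV \<Omega> (w\<^sub>n n) = ereal t" ..
        with elim show ?case unfolding Tn[OF w(1)] by (simp add: indicator_infty_def)
      qed
      then have "liminf (\<lambda>n. TR_functional \<Omega> \<alpha> \<Delta> (g\<^sub>n n) (v\<^sub>n n) (w\<^sub>n n)) = \<infinity>"
        by (intro lim_imp_Liminf tendsto_eventually) auto
      then show ?thesis by simp
    next
      case True
      let ?a = "\<lambda>n. ereal (J (w\<^sub>n n) n - \<alpha> * s\<^sub>n n)" and ?b = "\<lambda>n. ereal \<alpha> * TV \<Omega> (w\<^sub>n n)"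
      have a: "?a \<longlonglongrightarrow> ereal (?I - \<alpha> * s)"
        by (intro tendsto_ereal tendsto_diff tendsto_mult tendsto_const inner_lim w wlim slim)
      have "TV \<Omega> w \<le> liminf (\<lambda>n. TV \<Omega> (w\<^sub>n n))"
        by (rule TV_lower_semicontinuous[OF _ _ wlim]) (auto intro: int w)
      then have "ereal \<alpha> * TV \<Omega> w \<le> ereal \<alpha> * liminf (\<lambda>n. TV \<Omega> (w\<^sub>n n))"
        using \<alpha> by (intro ereal_mult_left_mono) auto
      also have "\<dots> = liminf ?b"
        using \<alpha> by (intro Liminf_ereal_mult_left[symmetric]) auto
      finally have b: "ereal \<alpha> * TV \<Omega> w \<le> liminf ?b" .
      have "TR_functional \<Omega> \<alpha> \<Delta> g v w = ereal (?I - \<alpha> * s) + ereal \<alpha> * TV \<Omega> w"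
        using True L1_norm_nonneg[of \<Omega> "\<lambda>x. w x - v x"] by (simp add: T[OF w(2)] indicator_infty_def)
      also have "\<dots> \<le> ereal (?I - \<alpha> * s) + liminf ?b"
        using b by (rule add_left_mono)
      also have "\<dots> = liminf (\<lambda>n. ?a n + ?b n)"
        by (rule ereal_liminf_lim_add[OF a, symmetric]) simp
      also have "\<dots> \<le> liminf (\<lambda>n. TR_functional \<Omega> \<alpha> \<Delta> (g\<^sub>n n) (v\<^sub>n n) (w\<^sub>n n))"
      proof (intro Liminf_mono always_eventually allI)
        fix n
        have "?a n + ?b n + 0 \<le> ?a n + ?b n + indicator_infty {0..\<Delta>} (L1_norm \<Omega> (\<lambda>x. w\<^sub>n n x - v\<^sub>n n x))"
          by (intro add_left_mono) (simp add: indicator_infty_def)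
        then show "?a n + ?b n \<le> TR_functional \<Omega> \<alpha> \<Delta> (g\<^sub>n n) (v\<^sub>n n) (w\<^sub>n n)"
          by (simp add: Tn[OF w(1)])
      qed
      finally show ?thesis .
    qed
  qed
  have upper: "\<exists>w\<^sub>n. (\<forall>n. w\<^sub>n n \<in> BV_values V \<Omega>) \<and> weak_star_converges \<Omega> w\<^sub>n w \<and>
      limsup (\<lambda>n. TR_functional \<Omega> \<alpha> \<Delta> (g\<^sub>n n) (v\<^sub>n n) (w\<^sub>n n)) \<le> TR_functional \<Omega> \<alpha> \<Delta> g v w"
    if w: "w \<in> BV_values V \<Omega>" for w
  proof -
    define t where "t = real_of_ereal (TV \<Omega> w)"
    have t: "TV \<Omega> w = ereal t" unfolding t_def by (rule BV_TV_finite[OF BVV[OF w]])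
    let ?I = "L2_inner \<Omega> g (\<lambda>x. w x - v x)"
    show ?thesis
    proof (cases "L1_norm \<Omega> (\<lambda>x. w x - v x) \<le> \<Delta>")
      case False
      then have "TR_functional \<Omega> \<alpha> \<Delta> g v w = \<infinity>" by (simp add: T[OF w] t indicator_infty_def)
      moreover have "weak_star_converges \<Omega> (\<lambda>_. w) w"
        using BVV[OF w] t by (simp add: weak_star_converges_def L1_norm_def Limsup_const)
      ultimately show ?thesis using w by (intro exI[of _ "\<lambda>_. w"]) simp
    next
      case True
      have "\<exists>w'. w' \<in> BV_values V \<Omega> \<and> L1_norm \<Omega> (\<lambda>x. w' x - w x) \<le> 1 / real (Suc k) \<and>
        TV \<Omega> w' \<le> TV \<Omega> w + ereal (1 / real (Suc k)) \<and> L1_norm \<Omega> (\<lambda>x. w' x - v x) < \<Delta>" for k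
        by (rule competitors_in_open_trust_region[OF assms(1) \<Omega> V w v \<Delta> True]) simp
      from choice[OF allI[OF this]] obtain W where Wall:
        "\<forall>k. W k \<in> BV_values V \<Omega> \<and> L1_norm \<Omega> (\<lambda>x. W k x - w x) \<le> 1 / real (Suc k) \<and>
        TV \<Omega> (W k) \<le> TV \<Omega> w + ereal (1 / real (Suc k)) \<and> L1_norm \<Omega> (\<lambda>x. W k x - v x) < \<Delta>" ..
      then have W: "W k \<in> BV_values V \<Omega>" "L1_norm \<Omega> (\<lambda>x. W k x - w x) \<le> 1 / real (Suc k)"
        "TV \<Omega> (W k) \<le> ereal (t + 1 / real (Suc k))" "L1_norm \<Omega> (\<lambda>x. W k x - v x) < \<Delta>" for k
        by (auto simp: t)
      have "\<forall>\<^sub>F n in sequentially. L1_norm \<Omega> (\<lambda>x. W k x - v\<^sub>n n x) < \<Delta>" for k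
      proof -
        have "(\<lambda>n. L1_norm \<Omega> (\<lambda>x. W k x - v\<^sub>n n x)) \<longlonglongrightarrow> L1_norm \<Omega> (\<lambda>x. W k x - v x)"
          by (rule dist_lim) (use W in \<open>auto simp: L1_norm_def\<close>)
        from order_tendstoD(2)[OF this W(4)] show ?thesis .
      qed
      then obtain \<kappa> where \<kappa>: "filterlim \<kappa> at_top sequentially"
        "\<forall>\<^sub>F n in sequentially. L1_norm \<Omega> (\<lambda>x. W (\<kappa> n) x - v\<^sub>n n x) < \<Delta>"
        using diagonal_selection[of "\<lambda>k n. L1_norm \<Omega> (\<lambda>x. W k x - v\<^sub>n n x) < \<Delta>"] by blast
      \<comment> \<open>The recovery sequence runs through the competitors slowly enough to remain feasible.\<close>
      define w\<^sub>n where "w\<^sub>n = (\<lambda>n. W (\<kappa> n))"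
      have wn: "w\<^sub>n n \<in> BV_values V \<Omega>" for n by (simp add: w\<^sub>n_def W)
      have \<kappa>0: "(\<lambda>n. 1 / real (Suc (\<kappa> n))) \<longlonglongrightarrow> 0"
        using filterlim_compose[OF LIMSEQ_inverse_real_of_nat \<kappa>(1)] by (simp add: inverse_eq_divide)
      have wlim: "(\<lambda>n. L1_norm \<Omega> (\<lambda>x. w\<^sub>n n x - w x)) \<longlonglongrightarrow> 0"
        by (rule tendsto_sandwich[OF _ _ tendsto_const \<kappa>0])
          (auto simp: w\<^sub>n_def L1_norm_nonneg simp del: of_nat_Suc intro!: always_eventually W)
      have "limsup (\<lambda>n. TV \<Omega> (w\<^sub>n n)) \<le> ereal (t + 1)"
      proof (intro Limsup_bounded always_eventually allI)
        fix n
        have "t + 1 / real (Suc (\<kappa> n)) \<le> t + 1" by simp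
        then show "TV \<Omega> (w\<^sub>n n) \<le> ereal (t + 1)"
          using W(3)[of "\<kappa> n"] unfolding w\<^sub>n_def by (meson ereal_less_eq(3) order_trans)
      qed
      then have "limsup (\<lambda>n. TV \<Omega> (w\<^sub>n n)) < \<infinity>" by (rule order_le_less_trans) simp
      then have ws: "weak_star_converges \<Omega> w\<^sub>n w"
        using wlim by (simp add: weak_star_converges_def BVV[OF wn] BVV[OF w])
      let ?c = "\<lambda>n. ereal (J (w\<^sub>n n) n - \<alpha> * s\<^sub>n n + \<alpha> * (t + 1 / real (Suc (\<kappa> n))))"
      have "limsup (\<lambda>n. TR_functional \<Omega> \<alpha> \<Delta> (g\<^sub>n n) (v\<^sub>n n) (w\<^sub>n n)) \<le> limsup ?c"
      proof (rule Limsup_mono)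
        show "\<forall>\<^sub>F n in sequentially. TR_functional \<Omega> \<alpha> \<Delta> (g\<^sub>n n) (v\<^sub>n n) (w\<^sub>n n) \<le> ?c n"
          using \<kappa>(2)
        proof eventually_elim
          case (elim n)
          have "ereal \<alpha> * TV \<Omega> (w\<^sub>n n) \<le> ereal \<alpha> * ereal (t + 1 / real (Suc (\<kappa> n)))"
            using \<alpha> W(3) by (intro ereal_mult_left_mono) (auto simp: w\<^sub>n_def)
          then have le: "ereal (J (w\<^sub>n n) n - \<alpha> * s\<^sub>n n) + ereal \<alpha> * TV \<Omega> (w\<^sub>n n)
            \<le> ereal (J (w\<^sub>n n) n - \<alpha> * s\<^sub>n n) + ereal \<alpha> * ereal (t + 1 / real (Suc (\<kappa> n)))"
            by (rule add_left_mono)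
          have "indicator_infty {0..\<Delta>} (L1_norm \<Omega> (\<lambda>x. w\<^sub>n n x - v\<^sub>n n x)) = 0"
            using elim by (simp add: indicator_infty_def w\<^sub>n_def L1_norm_nonneg)
          with le show ?case by (simp add: Tn[OF wn] del: of_nat_Suc)
        qed
      qed
      also have "\<dots> = ereal (?I - \<alpha> * s + \<alpha> * (t + 0))"
        by (intro lim_imp_Limsup tendsto_ereal tendsto_add tendsto_diff tendsto_mult tendsto_const
            inner_lim wn w wlim slim \<kappa>0) simp
      also have "\<dots> = TR_functional \<Omega> \<alpha> \<Delta> g v w"
        using True L1_norm_nonneg[of \<Omega> "\<lambda>x. w x - v x"] by (simp add: T[OF w] t indicator_infty_def)
      finally show ?thesis using wn ws by blast
    qed
  qed
  show ?thesis unfolding Gamma_converges_def using lower upper by blast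
qed

end
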